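(* Let $d$ be a positive integer. For every $i=1,\ldots,d$, let $\{A_n^{(i)}\}_n$ be a sparsely unbounded (s.u.) sequence of matrices and suppose that $\{B_{n,m}^{(i)}\}_n\xrightarrow{\rm a.c.s.}\{A_n^{(i)}\}_n$. Then $$\{B_{n,m}^{(1)}\otimes\cdots\otimes B_{n,m}^{(d)}\}_n\xrightarrow{\rm a.c.s.}\{A_n^{(1)}\otimes\cdots\otimes A_n^{(d)}\}_n.$$
   Context: A sequence of matrices is $\{A_n\}_n$ where $n$ varies in some infinite subset of $\mathbb N=\{1,2,\ldots\}$ (the same subset for all sequences involved) and $A_n$ is a complex matrix of size $d_n\times e_n$ with $d_n,e_n\to\infty$ as $n\to\infty$. $x\wedge y=\min(x,y)$; $\|\cdot\|$ is the spectral (operator 2-) norm; $\otimes$ is the Kronecker product, $X\otimes Y=[x_{ij}Y]_{i,j}$; $\sigma_i(A)$, $i=1,\ldots,m\wedge n$, are the singular values of $A\in\mathbb C^{m\times n}$. Sparsely unbounded: $\{A_n\}_n$, with $A_n$ of size $d_n\times e_n$, is s.u. if for every $M>0$ there exists $n_M$ such that, for $n\ge n_M$, $\frac{\#\{i\in\{1,\ldots,d_n\wedge e_n\}:\sigma_i(A_n)>M\}}{d_n\wedge e_n}\le r(M)$, where $r$ is a function of $M$ only with $\lim_{M\to\infty}r(M)=0$. Approximating class of sequences (a.c.s.): let $\{\{B_{n,m}\}_n\}_m$ be a sequence (indexed by $m$) of sequences of matrices with $B_{n,m}$ of the same size $d_n\times e_n$ as $A_n$. One writes $\{B_{n,m}\}_n\xrightarrow{\rm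 a.c.s.}\{A_n\}_n$ if for every $m$ there exists $n_m$ such that, for $n\ge n_m$, $A_n=B_{n,m}+R_{n,m}+N_{n,m}$ with ${\rm rank}(R_{n,m})\le c(m)(d_n\wedge e_n)$ and $\|N_{n,m}\|\le\omega(m)$, where $n_m,c(m),\omega(m)$ depend only on $m$ and $\lim_{m\to\infty}c(m)=\lim_{m\to\infty}\omega(m)=0$. *)

theory Defs
  imports
    "HOL-Analysis.Analysis"
    "HOL-Computational_Algebra.Computational_Algebra"
    "Jordan_Normal_Form.Char_Poly"
    "Jordan_Normal_Form.DL_Rank"
    "Jordan_Normal_Form.Schur_Decomposition"
begin

definition kron :: "complex mat \<Rightarrow> complex mat \<Rightarrow> complex mat" where
  "kron X Y = mat (dim_row X * dim_row Y) (dim_col X * dim_col Y)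
     (\<lambda>(i, j). X $$ (i div dim_row Y, j div dim_col Y) * Y $$ (i mod dim_row Y, j mod dim_col Y))"

text \<open>The iterated product starts from the \<open>1 \<times> 1\<close> identity, the unit of \<^const>\<open>kron\<close>
  (lemma \<open>kron_one_right\<close>), so that a nonempty list yields \<open>X\<^sub>1 \<otimes> (X\<^sub>2 \<otimes> \<dots>)\<close>.\<close>

definition kron_list :: "complex mat list \<Rightarrow> complex mat" where
  "kron_list Xs = foldr kron Xs (1\<^sub>m 1)"

lemma kron_one_right: "kron X (1\<^sub>m 1) = X"
  by (intro eq_matI) (simp_all add: kron_def)

lemma kron_list_single: "kron_list [X] = X"
  by (simp add: kron_list_def kron_one_right del: One_nat_def)

lemma kron_list_Cons: "kron_list (X # Xs) = kron X (kron_list Xs)"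
  by (simp add: kron_list_def)

definition mat_rank :: "complex mat \<Rightarrow> nat" where
  "mat_rank X = vec_space.rank (dim_row X) X"

definition vec_norm2 :: "complex vec \<Rightarrow> real" where
  "vec_norm2 v = sqrt (\<Sum>i<dim_vec v. (cmod (v $ i))\<^sup>2)"

definition spectral_norm :: "complex mat \<Rightarrow> real" where
  "spectral_norm X = (SUP v\<in>{v \<in> carrier_vec (dim_col X). vec_norm2 v \<le> 1}. vec_norm2 (X *\<^sub>v v))"

text \<open>The singular values of an \<open>m \<times> n\<close> matrix \<open>X\<close> are the \<open>min m n\<close> largest square roots of the
  \<open>n\<close> eigenvalues of \<open>X\<^sup>* X\<close>, counted with multiplicity, in nonincreasing order. These eigenvalues are
  real and nonnegative, so that taking real parts only changes the type; if \<open>n > m\<close>, the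
  values dropped are all zero.\<close>

definition singular_values :: "complex mat \<Rightarrow> real list" where
  "singular_values X = take (min (dim_row X) (dim_col X))
     (rev (sorted_list_of_multiset
       (image_mset (\<lambda>z. sqrt (Re z)) (proots (char_poly (mat_adjoint X * X))))))"

text \<open>The index \<open>i\<close> runs from \<open>1\<close> to \<open>min m n\<close>.\<close>

definition singular_value :: "complex mat \<Rightarrow> nat \<Rightarrow> real" where
  "singular_value X i = singular_values X ! (i - 1)"

lemma length_singular_values: "length (singular_values X) = min (dim_row X) (dim_col X)"
proof -
  have "mat_adjoint X * X \<in> carrier_mat (dim_col X) (dim_col X)"
    by (auto simp: mat_adjoint_def)
  then have "size (proots (char_poly (mat_adjoint X * X))) = dim_col X"
    by (simp add: size_proots_complex degree_monic_char_poly)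
  moreover have "length (sorted_list_of_multiset M) = size M" for M :: "real multiset"
    by (metis mset_sorted_list_of_multiset size_mset)
  ultimately show ?thesis
    by (simp add: singular_values_def)
qed

text \<open>A sequence of matrices indexed by an infinite set \<open>I\<close> of positive integers; values outside
  \<open>I\<close> are irrelevant. The sizes are those of the matrices \<open>A n\<close> themselves, and the limit
  \<open>n \<rightarrow> \<infinity>\<close> is taken along \<open>I\<close>.\<close>

definition matrix_sequence :: "nat set \<Rightarrow> (nat \<Rightarrow> complex mat) \<Rightarrow> bool" where
  "matrix_sequence I A \<longleftrightarrow> infinite I \<and> I \<subseteq> {1..} \<and>
     filterlim (\<lambda>n. dim_row (A n)) at_top (inf sequentially (principal I)) \<and>
     filterlim (\<lambda>n. dim_col (A n)) at_top (inf sequentially (principal I))"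

definition sparsely_unbounded :: "nat set \<Rightarrow> (nat \<Rightarrow> complex mat) \<Rightarrow> bool" where
  "sparsely_unbounded I A \<longleftrightarrow> matrix_sequence I A \<and>
     (\<exists>r :: real \<Rightarrow> real. (r \<longlongrightarrow> 0) at_top \<and>
       (\<forall>M>0. \<exists>n\<^sub>M. \<forall>n\<in>I. n \<ge> n\<^sub>M \<longrightarrow>
          real (card {i \<in> {1..min (dim_row (A n)) (dim_col (A n))}. singular_value (A n) i > M})
            / real (min (dim_row (A n)) (dim_col (A n))) \<le> r M))"

text \<open>Here \<open>B m n\<close> is \<open>B\<^sub>n\<^sub>,\<^sub>m\<close>: the outer index is the class index \<open>m \<ge> 1\<close>, so that each \<open>B m\<close> is a
  sequence of matrices in \<open>n\<close>.\<close>

definition acs :: "nat set \<Rightarrow> (nat \<Rightarrow> nat \<Rightarrow> complex mat) \<Rightarrow> (nat \<Rightarrow> complex mat) \<Rightarrow> bool" where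
  "acs I B A \<longleftrightarrow> matrix_sequence I A \<and>
     (\<forall>m\<ge>1. \<forall>n\<in>I. B m n \<in> carrier_mat (dim_row (A n)) (dim_col (A n))) \<and>
     (\<exists>c \<omega> :: nat \<Rightarrow> real. c \<longlonglongrightarrow> 0 \<and> \<omega> \<longlonglongrightarrow> 0 \<and>
       (\<forall>m\<ge>1. \<exists>n\<^sub>m. \<forall>n\<in>I. n \<ge> n\<^sub>m \<longrightarrow>
         (\<exists>R N. R \<in> carrier_mat (dim_row (A n)) (dim_col (A n)) \<and>
                N \<in> carrier_mat (dim_row (A n)) (dim_col (A n)) \<and>
                A n = B m n + R + N \<and>
                real (mat_rank R) \<le> c m * real (min (dim_row (A n)) (dim_col (A n))) \<and>
                spectral_norm N \<le> \<omega> m)))"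

end

(* A sparsely unbounded sequence splits, for every M, as A = P + S with rank P at most r(M) times
   the smaller dimension and |S| <= M: truncate the singular value decomposition at M. Splittings
   of this kind pass to Kronecker products since rank is multiplicative and the spectral norm
   submultiplicative there, which replaces any discussion of the singular values of the product.
   If moreover A - B = R + N and A' - B' = R' + N', then
     A (x) A' - B (x) B' = (A - B) (x) A' + B (x) (A' - B')
   is a sum of Kronecker products each of which contains a factor of small rank or is a product of
   a factor N or N' with a factor of norm at most about M. Letting M tend to infinity slowly with m
   makes both error terms vanish. The case of d factors follows by induction. *)
theory Submission
  imports Defs "Jordan_Normal_Form.Spectral_Radius"
begin

text \<open>Nothing is assumed about the size of the approximants: the norms of \<open>A\<close> are
  unbounded, and \<open>B\<close> has no sparse unboundedness of its own. A splitting of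
  \<open>B\<close> is therefore borrowed from \<open>A\<close>: with \<open>A = P + S\<close> and
  \<open>A - B = R + N\<close> one has \<open>B = (P - R) + (S - N)\<close>, where the second part
  has norm at most \<open>M\<close> plus the norm bound for \<open>N\<close>. Only one-sided rank
  information enters: a Kronecker product has rank at most the rank of one factor times the smaller
  dimension of the other. Since the product of the smaller dimensions is at most the smaller
  dimension of the product, relative ranks simply add. With a fixed \<open>M\<close> the rank error
  r(M) would survive, so \<open>M\<close> must grow with m; it may depend on m alone, because the
  bounds in the a.c.s. definition do. Singular values are defined through the roots of the
  characteristic polynomial of \<open>mat_adjoint X * X\<close>. Truncation therefore rests on a
  unitary diagonalization of this Hermitian matrix; left singular vectors are never normalized, the
  columns of \<open>X * U\<close> take their place.\<close>

no_notation fps_nth (infixl "$" 75) and vec_nth (infixl "$" 90)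

section \<open>Rank and operator norm of Kronecker products\<close>

lemma dim_kron [simp]:
  "dim_row (kron X Y) = dim_row X * dim_row Y"
  "dim_col (kron X Y) = dim_col X * dim_col Y"
  by (simp_all add: kron_def)

lemma kron_index [simp]:
  assumes "i < dim_row X * dim_row Y" "j < dim_col X * dim_col Y"
  shows "kron X Y $$ (i, j) =
    X $$ (i div dim_row Y, j div dim_col Y) * Y $$ (i mod dim_row Y, j mod dim_col Y)"
  using assms by (simp add: kron_def)

lemma div_mod_less:
  assumes "i < m * (n :: nat)"
  shows "i div n < m" "i mod n < n"
proof -
  from assms have "n > 0" by (cases n) auto
  then show "i mod n < n" by simp
  show "i div n < m" using assms by (simp add: less_mult_imp_div_less)
qed

lemma sum_div_mod:
  fixes f :: "nat \<Rightarrow> nat \<Rightarrow> 'a :: comm_monoid_add"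
  shows "(\<Sum>k<a * b. f (k div b) (k mod b)) = (\<Sum>i<a. \<Sum>j<b. f i j)"
proof -
  have "(\<Sum>k<a * b. f (k div b) (k mod b)) =
      (\<Sum>i<a. \<Sum>k\<in>{i * b..<i * b + b}. f (k div b) (k mod b))"
    by (rule sum.nat_group [symmetric])
  also have "\<dots> = (\<Sum>i<a. \<Sum>j<b. f i j)"
  proof (rule sum.cong [OF refl])
    fix i
    show "(\<Sum>k\<in>{i * b..<i * b + b}. f (k div b) (k mod b)) = (\<Sum>j<b. f i j)"
      by (rule sum.reindex_bij_witness [where i = "\<lambda>j. i * b + j" and j = "\<lambda>k. k - i * b"])
        (use div_nat_eqI [of b i] in \<open>auto simp: minus_div_mult_eq_mod [symmetric]
          add.commute mult.commute [of b] intro!: arg_cong2 [where f = f]\<close>)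
  qed
  finally show ?thesis .
qed

section \<open>Rank bounds by sums of dyads\<close>

text \<open>A factorization of \<open>X\<close> with inner dimension \<open>k\<close>. The factors
  are plain functions, so that they can be padded, joined and reindexed without dimension
  conditions.\<close>

definition rank_le :: "nat \<Rightarrow> complex mat \<Rightarrow> bool" where
  "rank_le k X \<longleftrightarrow> (\<exists>y z. \<forall>i<dim_row X. \<forall>j<dim_col X. X $$ (i, j) = (\<Sum>l<k. y i l * z l j))"

lemma rank_leI:
  assumes "\<And>i j. i < dim_row X \<Longrightarrow> j < dim_col X \<Longrightarrow> X $$ (i, j) = (\<Sum>l<k. y i l * z l j)"
  shows "rank_le k X"
  using assms unfolding rank_le_def by blast

lemma rank_le_sum:
  assumes "finite S"
    and "\<And>i j. i < dim_row X \<Longrightarrow> j < dim_col X \<Longrightarrow> X $$ (i, j) = (\<Sum>l\<in>S. y i l * z l j)"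
  shows "rank_le (card S) X"
proof -
  obtain h where h: "bij_betw h {..<card S} S"
    using ex_bij_betw_nat_finite [OF assms(1)] by (auto simp: lessThan_atLeast0)
  show ?thesis
    by (rule rank_leI [where y = "\<lambda>i l. y i (h l)" and z = "\<lambda>l. z (h l)"])
      (simp add: assms(2) sum.reindex_bij_betw [OF h, where g = "\<lambda>l. y _ l * z l _", symmetric])
qed

text \<open>The factorizations are I X and X I.\<close>

lemma rank_le_dims:
  "rank_le (min (dim_row X) (dim_col X)) X"
proof -
  have "rank_le (dim_row X) X"
    by (rule rank_leI [where y = "\<lambda>i l. if i = l then 1 else 0" and z = "\<lambda>l j. X $$ (l, j)"])
      (simp add: if_distrib if_distribR sum.delta cong: if_cong)
  moreover have "rank_le (dim_col X) X"
    by (rule rank_leI [where z = "\<lambda>l j. if l = j then 1 else 0" and y = "\<lambda>i l. X $$ (i, l)"])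
      (simp add: if_distrib sum.delta cong: if_cong)
  ultimately show ?thesis by (simp add: min_def)
qed

lemma rank_le_mono:
  assumes "rank_le k X" "k \<le> k'"
  shows "rank_le k' X"
proof -
  obtain y z where yz: "\<forall>i<dim_row X. \<forall>j<dim_col X. X $$ (i, j) = (\<Sum>l<k. y i l * z l j)"
    using assms unfolding rank_le_def by blast
  have "(\<Sum>l<k'. (if l < k then y i l else 0) * z l j) = (\<Sum>l<k. y i l * z l j)" for i j
    using assms(2) by (intro sum.mono_neutral_cong_right) auto
  then show ?thesis
    using yz by (intro rank_leI [where y = "\<lambda>i l. if l < k then y i l else 0" and z = z]) simp
qed

lemma rank_le_add:
  assumes "rank_le k X" "rank_le l Y" "dim_row X = dim_row Y" "dim_col X = dim_col Y"
  shows "rank_le (k + l) (X + Y)"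
proof -
  obtain y z where yz: "\<forall>i<dim_row X. \<forall>j<dim_col X. X $$ (i, j) = (\<Sum>l<k. y i l * z l j)"
    using assms unfolding rank_le_def by blast
  obtain u v where uv: "\<forall>i<dim_row Y. \<forall>j<dim_col Y. Y $$ (i, j) = (\<Sum>p<l. u i p * v p j)"
    using assms unfolding rank_le_def by blast
  have "(\<Sum>p<k + l. (if p < k then y i p else u i (p - k)) * (if p < k then z p j else v (p - k) j))
      = (\<Sum>p<k. y i p * z p j) + (\<Sum>p<l. u i p * v p j)" for i j
  proof -
    have "{..<k + l} = {..<k} \<union> {k..<k + l}" by auto
    moreover have "(\<Sum>p\<in>{k..<k + l}. u i (p - k) * v (p - k) j) = (\<Sum>p<l. u i p * v p j)"
      by (rule sum.reindex_bij_witness [where i = "\<lambda>p. p + k" and j = "\<lambda>p. p - k"]) auto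
    ultimately show ?thesis
      by (simp add: sum.union_disjoint Int_def)
  qed
  then show ?thesis
    using yz uv assms(3,4)
    by (intro rank_leI [where y = "\<lambda>i p. if p < k then y i p else u i (p - k)"
          and z = "\<lambda>p j. if p < k then z p j else v (p - k) j"]) simp
qed

text \<open>The Kronecker product of two dyads is a dyad: the tensor products of their left and of
  their right vectors. The pair of summation indices is packed into one index \<open>r\<close>,
  decoded by \<open>div\<close> and \<open>mod\<close>.\<close>

lemma rank_le_kron:
  assumes "rank_le k X" "rank_le l Y"
  shows "rank_le (k * l) (kron X Y)"
proof -
  obtain y z where yz: "\<forall>i<dim_row X. \<forall>j<dim_col X. X $$ (i, j) = (\<Sum>l<k. y i l * z l j)"
    using assms unfolding rank_le_def by blast
  obtain u v where uv: "\<forall>i<dim_row Y. \<forall>j<dim_col Y. Y $$ (i, j) = (\<Sum>p<l. u i p * v p j)"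
    using assms unfolding rank_le_def by blast
  show ?thesis
  proof (rule rank_leI)
    fix i j assume "i < dim_row (kron X Y)" "j < dim_col (kron X Y)"
    then have ij: "i < dim_row X * dim_row Y" "j < dim_col X * dim_col Y" by auto
    have "kron X Y $$ (i, j) = (\<Sum>p<k. y (i div dim_row Y) p * z p (j div dim_col Y)) *
        (\<Sum>q<l. u (i mod dim_row Y) q * v q (j mod dim_col Y))"
      using ij yz uv by (simp add: div_mod_less)
    also have "\<dots> = (\<Sum>p<k. \<Sum>q<l. (y (i div dim_row Y) p * u (i mod dim_row Y) q) *
        (z p (j div dim_col Y) * v q (j mod dim_col Y)))"
      unfolding sum_product by (intro sum.cong refl) (simp only: mult_ac)
    also have "\<dots> = (\<Sum>r<k * l. (y (i div dim_row Y) (r div l) * u (i mod dim_row Y) (r mod l)) *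
        (z (r div l) (j div dim_col Y) * v (r mod l) (j mod dim_col Y)))"
      by (rule sum_div_mod [symmetric])
    finally show "kron X Y $$ (i, j)
        = (\<Sum>r<k * l. (y (i div dim_row Y) (r div l) * u (i mod dim_row Y) (r mod l)) *
        (z (r div l) (j div dim_col Y) * v (r mod l) (j mod dim_col Y)))" .
  qed
qed

text \<open>A column outside the span could be added to \<open>S\<close> without destroying
  independence, against maximality.\<close>

lemma (in vec_space) cols_in_span_maximal:
  assumes X: "X \<in> carrier_mat n nc"
    and S: "maximal S (\<lambda>T. T \<subseteq> set (cols X) \<and> lin_indpt T)"
    and v: "v \<in> set (cols X)"
  shows "v \<in> span S"
proof (rule ccontr)
  assume "v \<notin> span S"
  have sub: "S \<subseteq> set (cols X)" and ind: "lin_indpt S"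
    using S by (auto simp: maximal_def)
  have car: "set (cols X) \<subseteq> carrier_vec n"
    using cols_dim X by blast
  have vS: "v \<notin> S"
    using \<open>v \<notin> span S\<close> sub car span_mem by auto
  have "lin_indpt (insert v S)"
    using lin_dep_iff_in_span [of S v] \<open>v \<notin> span S\<close> sub car ind v vS by auto
  then have "insert v S = S"
    using S sub v unfolding maximal_def by auto
  with vS show False by auto
qed

text \<open>A maximal independent set of columns has \<open>mat_rank X\<close> elements and spans
  all columns; the coefficients form the right factor.\<close>

lemma rank_le_mat_rank: "rank_le (mat_rank X) X"
proof -
  interpret vec_space "TYPE(complex)" "dim_row X" .
  have X: "X \<in> carrier_mat (dim_row X) (dim_col X)" by simp
  obtain S where S: "maximal S (\<lambda>T. T \<subseteq> set (cols X) \<and> lin_indpt T)"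
    using maximal_exists_superset [of "set (cols X)" "\<lambda>T. T \<subseteq> set (cols X) \<and> lin_indpt T" "{}"]
    by (auto simp: lin_dep_def)
  have sub: "S \<subseteq> set (cols X)"
    using S by (auto simp: maximal_def)
  then have fin: "finite S" and car: "S \<subseteq> carrier_vec (dim_row X)"
    using finite_subset cols_dim X by blast+
  have "\<forall>j<dim_col X. \<exists>a. col X j = lincomb a S"
  proof (intro allI impI)
    fix j assume "j < dim_col X"
    then have "col X j \<in> set (cols X)" by (simp add: cols_def)
    then have "col X j \<in> span S" by (rule cols_in_span_maximal [OF X S])
    then show "\<exists>a. col X j = lincomb a S" using finite_span [OF fin] car by auto
  qed
  then obtain a where a: "\<And>j. j < dim_col X \<Longrightarrow> col X j = lincomb (a j) S" by metis
  have "rank_le (card S) X"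
  proof (rule rank_le_sum [OF fin, where y = "\<lambda>i s. vec_index s i" and z = "\<lambda>s j. a j s"])
    fix i j assume ij: "i < dim_row X" "j < dim_col X"
    then have "X $$ (i, j) = col X j $ i" by simp
    also have "\<dots> = (\<Sum>s\<in>S. s $ i * a j s)"
      using lincomb_index [OF ij(1) car] a ij by (simp add: mult.commute)
    finally show "X $$ (i, j) = (\<Sum>s\<in>S. s $ i * a j s)" .
  qed
  then show ?thesis
    using rank_card_indpt [OF X S] by (simp add: mat_rank_def)
qed

text \<open>Each dyad has rank at most 1, so by subadditivity every step of the partial sums
  \<open>P q\<close> raises the rank by at most 1.\<close>

lemma mat_rank_le:
  assumes "rank_le k X"
  shows "mat_rank X \<le> k"
proof -
  interpret vec_space "TYPE(complex)" "dim_row X" .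
  obtain y z where yz: "\<And>i j. i < dim_row X \<Longrightarrow> j < dim_col X \<Longrightarrow> X $$ (i, j) = (\<Sum>l<k. y i l * z l j)"
    using assms unfolding rank_le_def by blast
  define P where "P q = mat (dim_row X) (dim_col X) (\<lambda>(i, j). \<Sum>l<q. y i l * z l j)" for q :: nat
  have "rank (P q) \<le> q" for q
  proof (induction q)
    case 0
    have "P 0 = 0\<^sub>m (dim_row X) (dim_col X)" by (auto simp: P_def)
    then show ?case by (simp add: rank_0I)
  next
    case (Suc q)
    define E where "E = mat (dim_row X) (dim_col X) (\<lambda>(i, j). y i q * z q j)"
    have "P (Suc q) = P q + E" by (auto simp: P_def E_def)
    moreover have "rank (P q + E) \<le> rank (P q) + rank E"
      by (rule rank_subadditive) (auto simp: P_def E_def)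
    moreover have "rank E \<le> 1"
      by (rule rank_le_1_product_entries [of _ "dim_col X" "\<lambda>i. y i q" "\<lambda>j. z q j"]) (auto simp: E_def)
    ultimately show ?case using Suc by simp
  qed
  moreover have "X = P k" by (auto simp: P_def yz)
  ultimately show ?thesis unfolding mat_rank_def by metis
qed

section \<open>Operator norm bounds and the spectral norm\<close>

text \<open>A bound for the norm instead of its value as a supremum, with vectors as functions, so
  that sums can be split into blocks. The sign condition is included because
  \<open>C\<^sup>2\<close> does not see it.\<close>

definition opnorm_le :: "real \<Rightarrow> complex mat \<Rightarrow> bool" where
  "opnorm_le C X \<longleftrightarrow> 0 \<le> C \<and>
    (\<forall>v. (\<Sum>i<dim_row X. (cmod (\<Sum>j<dim_col X. X $$ (i, j) * v j))\<^sup>2)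
      \<le> C\<^sup>2 * (\<Sum>j<dim_col X. (cmod (v j))\<^sup>2))"

lemma opnorm_leD:
  "opnorm_le C X \<Longrightarrow> (\<Sum>i<dim_row X. (cmod (\<Sum>j<dim_col X. X $$ (i, j) * v j))\<^sup>2)
      \<le> C\<^sup>2 * (\<Sum>j<dim_col X. (cmod (v j))\<^sup>2)"
  by (simp add: opnorm_le_def)

lemma opnorm_le_mono:
  assumes "opnorm_le C X" "C \<le> D"
  shows "opnorm_le D X"
proof -
  have "C\<^sup>2 \<le> D\<^sup>2" using assms by (intro power_mono) (auto simp: opnorm_le_def)
  then have "C\<^sup>2 * (\<Sum>j<dim_col X. (cmod (v j))\<^sup>2) \<le> D\<^sup>2 * (\<Sum>j<dim_col X. (cmod (v j))\<^sup>2)" for v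
    by (intro mult_right_mono sum_nonneg) auto
  then show ?thesis using assms unfolding opnorm_le_def by (meson order.trans)
qed

lemma opnorm_le_uminus: "opnorm_le C X \<Longrightarrow> opnorm_le C (- X)"
  by (simp add: opnorm_le_def sum_negf)

text \<open>The form without squares, to which Minkowski's inequality applies.\<close>

lemma opnorm_le_iff_L2_set:
  "opnorm_le C X \<longleftrightarrow> 0 \<le> C \<and> (\<forall>v. L2_set (\<lambda>i. cmod (\<Sum>j<dim_col X. X $$ (i, j) * v j)) {..<dim_row X}
      \<le> C * L2_set (\<lambda>j. cmod (v j)) {..<dim_col X})"
proof (cases "0 \<le> C")
  case True
  have "L2_set f A \<le> C * L2_set g B \<longleftrightarrow> (\<Sum>i\<in>A. (f i)\<^sup>2) \<le> C\<^sup>2 * (\<Sum>j\<in>B. (g j)\<^sup>2)"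
    for f g :: "nat \<Rightarrow> real" and A B
  proof -
    have "C * L2_set g B = sqrt (C\<^sup>2 * (\<Sum>j\<in>B. (g j)\<^sup>2))"
      using True by (simp add: L2_set_def real_sqrt_mult)
    then show ?thesis by (simp add: L2_set_def)
  qed
  then show ?thesis by (simp add: opnorm_le_def)
qed (simp add: opnorm_le_def)

lemma opnorm_le_add:
  assumes "opnorm_le C X" "opnorm_le D Y" and d: "dim_row X = dim_row Y" "dim_col X = dim_col Y"
  shows "opnorm_le (C + D) (X + Y)"
  unfolding opnorm_le_iff_L2_set
proof (intro conjI allI)
  show "0 \<le> C + D" using assms by (simp add: opnorm_le_def)
  fix v
  let ?x = "\<lambda>i. \<Sum>j<dim_col X. X $$ (i, j) * v j" and ?y = "\<lambda>i. \<Sum>j<dim_col Y. Y $$ (i, j) * v j"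
  let ?v = "L2_set (\<lambda>j. cmod (v j)) {..<dim_col Y}"
  have "L2_set (\<lambda>i. cmod (\<Sum>j<dim_col (X + Y). (X + Y) $$ (i, j) * v j)) {..<dim_row (X + Y)}
      \<le> L2_set (\<lambda>i. cmod (?x i) + cmod (?y i)) {..<dim_row Y}"
    unfolding index_add_mat
    by (rule L2_set_mono) (auto simp: d distrib_right sum.distrib intro: norm_triangle_ineq)
  also have "\<dots> \<le> L2_set (\<lambda>i. cmod (?x i)) {..<dim_row Y} + L2_set (\<lambda>i. cmod (?y i)) {..<dim_row Y}"
    by (rule L2_set_triangle_ineq)
  also have "\<dots> \<le> C * ?v + D * ?v"
    using assms by (intro add_mono) (auto simp: opnorm_le_iff_L2_set)
  finally show "L2_set (\<lambda>i. cmod (\<Sum>j<dim_col (X + Y). (X + Y) $$ (i, j) * v j)) {..<dim_row (X + Y)}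
      \<le> (C + D) * L2_set (\<lambda>j. cmod (v j)) {..<dim_col (X + Y)}"
    by (simp add: distrib_right)
qed

text \<open>This is the factorization of \<open>X \<otimes> Y\<close> into
  \<open>X \<otimes> I\<close> and \<open>I \<otimes> Y\<close>: \<open>w p j\<close> is entry
  \<open>p\<close> of \<open>Y\<close> applied to block \<open>j\<close> of \<open>v\<close>, and
  then \<open>X\<close> acts on \<open>w p\<close> for each fixed \<open>p\<close>.\<close>

lemma opnorm_le_kron:
  assumes X: "opnorm_le C X" and Y: "opnorm_le D Y"
  shows "opnorm_le (C * D) (kron X Y)"
  unfolding opnorm_le_def
proof (intro conjI allI)
  show "0 \<le> C * D" using assms by (simp add: opnorm_le_def)
  fix v :: "nat \<Rightarrow> complex"
  define w where "w i j = (\<Sum>q<dim_col Y. Y $$ (i, q) * v (j * dim_col Y + q))" for i j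
  have entry: "(\<Sum>j<dim_col X * dim_col Y. kron X Y $$ (i, j) * v j)
      = (\<Sum>j<dim_col X. X $$ (i div dim_row Y, j) * w (i mod dim_row Y) j)"
    if i: "i < dim_row X * dim_row Y" for i
  proof -
    have "(\<Sum>j<dim_col X * dim_col Y. kron X Y $$ (i, j) * v j) =
      (\<Sum>j<dim_col X * dim_col Y. (X $$ (i div dim_row Y, j div dim_col Y) *
         Y $$ (i mod dim_row Y, j mod dim_col Y)) * v (j div dim_col Y * dim_col Y + j mod dim_col Y))"
      using i by (intro sum.cong) auto
    also have "\<dots> = (\<Sum>j<dim_col X. \<Sum>q<dim_col Y. (X $$ (i div dim_row Y, j) *
         Y $$ (i mod dim_row Y, q)) * v (j * dim_col Y + q))"
      by (rule sum_div_mod)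
    finally show ?thesis by (simp add: w_def sum_distrib_left mult.assoc)
  qed
  have "(\<Sum>i<dim_row (kron X Y). (cmod (\<Sum>j<dim_col (kron X Y). kron X Y $$ (i, j) * v j))\<^sup>2)
      = (\<Sum>i<dim_row X * dim_row Y. (cmod (\<Sum>j<dim_col X. X $$ (i div dim_row Y, j) * w (i mod dim_row Y) j))\<^sup>2)"
    using entry by simp
  also have "\<dots> = (\<Sum>i<dim_row X. \<Sum>p<dim_row Y. (cmod (\<Sum>j<dim_col X. X $$ (i, j) * w p j))\<^sup>2)"
    by (rule sum_div_mod)
  also have "\<dots> = (\<Sum>p<dim_row Y. \<Sum>i<dim_row X. (cmod (\<Sum>j<dim_col X. X $$ (i, j) * w p j))\<^sup>2)"
    by (rule sum.swap)
  also have "\<dots> \<le> (\<Sum>p<dim_row Y. C\<^sup>2 * (\<Sum>j<dim_col X. (cmod (w p j))\<^sup>2))"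
    by (intro sum_mono opnorm_leD X)
  also have "\<dots> = C\<^sup>2 * (\<Sum>p<dim_row Y. \<Sum>j<dim_col X. (cmod (w p j))\<^sup>2)"
    by (simp add: sum_distrib_left)
  also have "(\<Sum>p<dim_row Y. \<Sum>j<dim_col X. (cmod (w p j))\<^sup>2)
      = (\<Sum>j<dim_col X. \<Sum>p<dim_row Y. (cmod (w p j))\<^sup>2)"
    by (rule sum.swap)
  also have "C\<^sup>2 * \<dots> \<le> C\<^sup>2 * (\<Sum>j<dim_col X. D\<^sup>2 * (\<Sum>q<dim_col Y. (cmod (v (j * dim_col Y + q)))\<^sup>2))"
    unfolding w_def by (intro mult_left_mono sum_mono opnorm_leD Y) auto
  also have "\<dots> = (C * D)\<^sup>2 * (\<Sum>j<dim_col X. \<Sum>q<dim_col Y. (cmod (v (j * dim_col Y + q)))\<^sup>2)"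
    by (simp add: sum_distrib_left power_mult_distrib mult.assoc)
  also have "(\<Sum>j<dim_col X. \<Sum>q<dim_col Y. (cmod (v (j * dim_col Y + q)))\<^sup>2) =
      (\<Sum>j<dim_col X * dim_col Y. (cmod (v (j div dim_col Y * dim_col Y + j mod dim_col Y)))\<^sup>2)"
    by (rule sum_div_mod [symmetric])
  finally show "(\<Sum>i<dim_row (kron X Y). (cmod (\<Sum>j<dim_col (kron X Y). kron X Y $$ (i, j) * v j))\<^sup>2)
      \<le> (C * D)\<^sup>2 * (\<Sum>j<dim_col (kron X Y). (cmod (v j))\<^sup>2)"
    by simp
qed

text \<open>A crude bound by the sum of all moduli of entries; it makes the supremum in
  \<open>spectral_norm\<close> a supremum of a bounded set.\<close>

lemma ex_opnorm_le: "\<exists>C. opnorm_le C X"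
proof -
  define C where "C = (\<Sum>i<dim_row X. \<Sum>j<dim_col X. cmod (X $$ (i, j)))"
  have "L2_set (\<lambda>i. cmod (\<Sum>j<dim_col X. X $$ (i, j) * v j)) {..<dim_row X}
      \<le> C * L2_set (\<lambda>j. cmod (v j)) {..<dim_col X}" for v
  proof -
    let ?v = "L2_set (\<lambda>j. cmod (v j)) {..<dim_col X}"
    have "L2_set (\<lambda>i. cmod (\<Sum>j<dim_col X. X $$ (i, j) * v j)) {..<dim_row X}
        \<le> (\<Sum>i<dim_row X. cmod (\<Sum>j<dim_col X. X $$ (i, j) * v j))"
      by (rule L2_set_le_sum) auto
    also have "\<dots> \<le> (\<Sum>i<dim_row X. \<Sum>j<dim_col X. cmod (X $$ (i, j)) * ?v)"
      by (intro sum_mono sum_norm_le)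
        (auto simp: norm_mult intro!: mult_left_mono member_le_L2_set)
    also have "\<dots> = C * ?v" by (simp add: C_def sum_distrib_right)
    finally show ?thesis .
  qed
  moreover have "0 \<le> C" by (simp add: C_def sum_nonneg)
  ultimately show ?thesis using opnorm_le_iff_L2_set by blast
qed

lemma vec_norm2_conv_L2_set: "vec_norm2 v = L2_set (\<lambda>i. cmod (v $ i)) {..<dim_vec v}"
  by (simp add: vec_norm2_def L2_set_def)

lemma vec_norm2_mult_mat_vec:
  assumes "v \<in> carrier_vec (dim_col X)"
  shows "vec_norm2 (X *\<^sub>v v) = L2_set (\<lambda>i. cmod (\<Sum>j<dim_col X. X $$ (i, j) * v $ j)) {..<dim_row X}"
  unfolding vec_norm2_conv_L2_set
  using assms by (intro L2_set_cong)
    (auto simp: scalar_prod_def lessThan_atLeast0 intro!: arg_cong [where f = cmod] sum.cong)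

lemma vec_norm2_mult_le:
  assumes "opnorm_le C X" "v \<in> carrier_vec (dim_col X)"
  shows "vec_norm2 (X *\<^sub>v v) \<le> C * vec_norm2 v"
proof -
  have "L2_set (\<lambda>i. cmod (\<Sum>j<dim_col X. X $$ (i, j) * v $ j)) {..<dim_row X}
      \<le> C * L2_set (\<lambda>j. cmod (v $ j)) {..<dim_col X}"
    using assms(1) by (simp add: opnorm_le_iff_L2_set)
  then show ?thesis
    using assms(2) by (simp add: vec_norm2_mult_mat_vec [OF assms(2)] vec_norm2_conv_L2_set [of v])
qed

lemma spectral_norm_le:
  assumes "opnorm_le C X"
  shows "spectral_norm X \<le> C"
  unfolding spectral_norm_def
proof (rule cSUP_least)
  have "0\<^sub>v (dim_col X) \<in> {v \<in> carrier_vec (dim_col X). vec_norm2 v \<le> 1}"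
    by (simp add: vec_norm2_def)
  then show "{v \<in> carrier_vec (dim_col X). vec_norm2 v \<le> 1} \<noteq> {}" by blast
  fix v assume "v \<in> {v \<in> carrier_vec (dim_col X). vec_norm2 v \<le> 1}"
  then have v: "v \<in> carrier_vec (dim_col X)" "vec_norm2 v \<le> 1" by auto
  have "vec_norm2 (X *\<^sub>v v) \<le> C * vec_norm2 v"
    using assms v(1) by (rule vec_norm2_mult_le)
  also have "\<dots> \<le> C * 1"
    using assms v by (intro mult_left_mono) (auto simp: opnorm_le_def)
  finally show "vec_norm2 (X *\<^sub>v v) \<le> C" by simp
qed

lemma opnorm_le_spectral_norm: "opnorm_le (spectral_norm X) X"
proof -
  let ?S = "{v \<in> carrier_vec (dim_col X). vec_norm2 v \<le> 1}"
  obtain C where C: "opnorm_le C X" using ex_opnorm_le by blast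
  have "vec_norm2 (X *\<^sub>v v) \<le> C" if "v \<in> ?S" for v
  proof -
    have "vec_norm2 (X *\<^sub>v v) \<le> C * vec_norm2 v"
      using C that by (intro vec_norm2_mult_le) auto
    also have "\<dots> \<le> C * 1"
      using C that by (intro mult_left_mono) (auto simp: opnorm_le_def)
    finally show ?thesis by simp
  qed
  then have bdd: "bdd_above ((\<lambda>v. vec_norm2 (X *\<^sub>v v)) ` ?S)" by (auto intro!: bdd_aboveI2)
  have up: "vec_norm2 (X *\<^sub>v v) \<le> spectral_norm X" if "v \<in> ?S" for v
    unfolding spectral_norm_def by (rule cSUP_upper [OF that bdd])
  have "0 \<le> vec_norm2 (X *\<^sub>v 0\<^sub>v (dim_col X))" by (simp add: vec_norm2_conv_L2_set)
  also have "\<dots> \<le> spectral_norm X" by (rule up) (simp add: vec_norm2_def)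
  finally have nonneg: "0 \<le> spectral_norm X" .
  show ?thesis
    unfolding opnorm_le_iff_L2_set
  proof (intro conjI allI nonneg)
    fix v :: "nat \<Rightarrow> complex"
    let ?v = "L2_set (\<lambda>j. cmod (v j)) {..<dim_col X}"
    let ?Xv = "L2_set (\<lambda>i. cmod (\<Sum>j<dim_col X. X $$ (i, j) * v j)) {..<dim_row X}"
    show "?Xv \<le> spectral_norm X * ?v"
    \<comment> \<open>A zero vector cannot be normalized; there the crude constant \<open>C\<close>
      already forces the image to be zero.\<close>
    proof (cases "?v = 0")
      case True
      moreover have "?Xv \<le> C * ?v" using C by (auto simp: opnorm_le_iff_L2_set)
      ultimately show ?thesis by simp
    next
      case False
      then have pos: "?v > 0" using L2_set_nonneg [of "\<lambda>j. cmod (v j)" "{..<dim_col X}"] by linarith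
      define u where "u = vec (dim_col X) (\<lambda>j. v j / ?v)"
      have "vec_norm2 u = L2_set (\<lambda>j. (1 / ?v) * cmod (v j)) {..<dim_col X}"
        unfolding vec_norm2_conv_L2_set using pos
        by (intro L2_set_cong) (auto simp: u_def norm_divide)
      also have "\<dots> = (1 / ?v) * ?v"
        using pos by (intro L2_set_right_distrib [symmetric]) auto
      finally have "vec_norm2 u = 1" using pos by simp
      then have "vec_norm2 (X *\<^sub>v u) \<le> spectral_norm X" by (intro up) (simp add: u_def)
      moreover have "vec_norm2 (X *\<^sub>v u)
          = L2_set (\<lambda>i. (1 / ?v) * cmod (\<Sum>j<dim_col X. X $$ (i, j) * v j)) {..<dim_row X}"
      proof -
        have "(\<Sum>j<dim_col X. X $$ (i, j) * u $ j) = (\<Sum>j<dim_col X. X $$ (i, j) * v j) / ?v" for i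
          by (simp add: u_def sum_divide_distrib)
        then show ?thesis
          using pos by (subst vec_norm2_mult_mat_vec) (auto simp: u_def norm_divide)
      qed
      moreover have "\<dots> = (1 / ?v) * ?Xv"
        using pos by (intro L2_set_right_distrib [symmetric]) auto
      ultimately have "(1 / ?v) * ?Xv \<le> spectral_norm X" by simp
      then show ?thesis using pos by (simp add: pos_divide_le_eq)
    qed
  qed
qed

section \<open>Unitary diagonalization of Hermitian matrices\<close>

lemma assoc_mult_mat_dim:
  fixes A :: "'a :: semiring_0 mat"
  assumes "dim_col A = dim_row B" "dim_col B = dim_row C"
  shows "A * B * C = A * (B * C)"
  by (rule assoc_mult_mat) (use assms in \<open>auto intro: carrier_matI\<close>)

lemma dim_mat_adjoint [simp]:
  "dim_row (mat_adjoint A) = dim_col A" "dim_col (mat_adjoint A) = dim_row A"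
  by (simp_all add: mat_adjoint_def)

lemma mat_adjoint_carrier [simp]: "A \<in> carrier_mat m n \<Longrightarrow> mat_adjoint A \<in> carrier_mat n m"
  by (auto intro: carrier_matI)

lemma mat_adjoint_index [simp]:
  assumes "i < dim_col A" "j < dim_row A"
  shows "mat_adjoint A $$ (i, j) = conjugate (A $$ (j, i))"
  using assms by (simp add: mat_adjoint_def mat_of_rows_def)

lemma mat_adjoint_adjoint [simp]: "mat_adjoint (mat_adjoint A) = A"
  by (rule eq_matI) auto

lemma mat_adjoint_mult:
  assumes "dim_col A = dim_row B"
  shows "mat_adjoint (A * B) = mat_adjoint B * mat_adjoint (A :: 'a :: conjugatable_field mat)"
proof (rule eq_matI)
  fix i j assume "i < dim_row (mat_adjoint B * mat_adjoint A)"
    "j < dim_col (mat_adjoint B * mat_adjoint A)"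
  then have ij: "i < dim_col B" "j < dim_row A" by auto
  show "mat_adjoint (A * B) $$ (i, j) = (mat_adjoint B * mat_adjoint A) $$ (i, j)"
    using ij assms
    by (auto simp: scalar_prod_def sum_conjugate conjugate_dist_mul mult.commute intro!: sum.cong)
qed auto

lemma mat_adjoint_one [simp]: "mat_adjoint (1\<^sub>m n :: complex mat) = 1\<^sub>m n"
  by (rule eq_matI) auto

lemma mat_adjoint_four_block_diag:
  assumes "A \<in> carrier_mat k k" "B \<in> carrier_mat n n"
  shows "mat_adjoint (four_block_mat A (0\<^sub>m k n) (0\<^sub>m n k) B) =
    four_block_mat (mat_adjoint A) (0\<^sub>m k n) (0\<^sub>m n k) (mat_adjoint (B :: complex mat))"
  using assms by (intro eq_matI) auto

lemma four_block_diag_mult: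
  assumes "A \<in> carrier_mat k k" "B \<in> carrier_mat n n" "A' \<in> carrier_mat k k" "B' \<in> carrier_mat n n"
  shows "four_block_mat A (0\<^sub>m k n) (0\<^sub>m n k) B * four_block_mat A' (0\<^sub>m k n) (0\<^sub>m n k) B' =
    four_block_mat (A * A') (0\<^sub>m k n) (0\<^sub>m n k) (B * (B' :: complex mat))"
  using assms by (subst mult_four_block_mat [where ?nr1.0 = k and ?nr2.0 = n
    and ?n1.0 = k and ?n2.0 = n and ?nc1.0 = k and ?nc2.0 = n]) auto

text \<open>Gram-Schmidt yields orthogonal vectors starting with \<open>v\<close>; dividing each by
  its own length gives the unitary matrix and accounts for the scalar \<open>c\<close>.\<close>

lemma unitary_with_first_col:
  fixes v :: "complex vec"
  assumes v: "v \<in> carrier_vec n" and v0: "v \<noteq> 0\<^sub>v n"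
  obtains W c where "W \<in> carrier_mat n n" "mat_adjoint W * W = 1\<^sub>m n" "col W 0 = c \<cdot>\<^sub>v v"
proof -
  interpret cof_vec_space n "TYPE(complex)" .
  define b where "b = basis_completion v"
  define ws where "ws = gram_schmidt n b"
  note b = basis_completion [OF v v0, folded b_def]
  have n: "n \<noteq> 0" using v v0 by auto
  then obtain vs where bv: "b = v # vs"
    using b(6,7) by (cases b) auto
  from gram_schmidt_result [OF b(2,4,5) refl, folded ws_def]
  have ws: "set ws \<subseteq> carrier_vec n" "corthogonal ws" "length ws = n"
    by (auto simp: b)
  have hdws: "hd ws = v"
    using gram_schmidt_hd [OF v, of vs, folded bv] unfolding ws_def .
  define nrm where "nrm w = sqrt (Re (w \<bullet>c w))" for w :: "complex vec"
  have wsn: "ws ! i \<in> carrier_vec n" if "i < n" for i using ws that by auto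
  have nrm: "nrm (ws ! i) \<noteq> 0" "complex_of_real (nrm (ws ! i)) * nrm (ws ! i) = ws ! i \<bullet>c ws ! i"
    if "i < n" for i
  proof -
    have "ws ! i \<bullet>c ws ! i \<noteq> 0" "ws ! i \<bullet>c ws ! i \<ge> 0"
      using corthogonalD [OF ws(2)] that ws(3) conjugate_square_ge_0_vec [of "ws ! i"] by auto
    then have "Re (ws ! i \<bullet>c ws ! i) > 0" "Im (ws ! i \<bullet>c ws ! i) = 0"
      by (auto simp: less_eq_complex_def complex_eq_iff)
    then show "nrm (ws ! i) \<noteq> 0" "complex_of_real (nrm (ws ! i)) * nrm (ws ! i) = ws ! i \<bullet>c ws ! i"
      by (auto simp: nrm_def complex_eq_iff)
  qed
  define W where "W = mat_of_cols n (map (\<lambda>w. complex_of_real (1 / nrm w) \<cdot>\<^sub>v w) ws)"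
  have W: "W \<in> carrier_mat n n" using mat_of_cols_carrier(1) [of n "map _ ws"] ws(3)
    unfolding W_def by (metis length_map)
  have col: "col W i = complex_of_real (1 / nrm (ws ! i)) \<cdot>\<^sub>v ws ! i" if "i < n" for i
    using that ws wsn by (simp add: W_def)
  have "mat_adjoint W * W = 1\<^sub>m n"
  proof (rule eq_matI)
    fix i j assume "i < dim_row (1\<^sub>m n :: complex mat)" "j < dim_col (1\<^sub>m n :: complex mat)"
    then have ij: "i < n" "j < n" by auto
    have "(mat_adjoint W * W) $$ (i, j) = col W j \<bullet>c col W i"
      using ij W by (auto simp: scalar_prod_def mult.commute intro!: sum.cong)
    also have "\<dots> = complex_of_real (1 / nrm (ws ! j)) * complex_of_real (1 / nrm (ws ! i))
        * (ws ! j \<bullet>c ws ! i)"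
      using ij wsn [of i] wsn [of j] by (simp add: col conjugate_smult_vec)
    also have "\<dots> = 1\<^sub>m n $$ (i, j)"
    proof (cases "i = j")
      case True
      then show ?thesis using ij nrm [of j] by (simp flip: nrm(2))
    next
      case False
      then show ?thesis using ij corthogonalD [OF ws(2), of j i] ws(3) by auto
    qed
    finally show "(mat_adjoint W * W) $$ (i, j) = 1\<^sub>m n $$ (i, j)" .
  qed (use W in auto)
  moreover have "ws ! 0 = v" using hdws ws(3) n by (cases ws) auto
  then have "col W 0 = complex_of_real (1 / nrm v) \<cdot>\<^sub>v v" using col [of 0] n by simp
  ultimately show ?thesis using that W by blast
qed

text \<open>Deflation: in a unitary basis beginning with an eigenvector, a Hermitian matrix splits
  into a 1 by 1 block and a smaller Hermitian block. The entries of \<open>D\<close> are not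
  asserted to be real; later only their real parts occur.\<close>

lemma hermitian_unitary_diagonalization:
  fixes H :: "complex mat"
  assumes "H \<in> carrier_mat n n" "mat_adjoint H = H"
  shows "\<exists>U D. U \<in> carrier_mat n n \<and> D \<in> carrier_mat n n \<and> mat_adjoint U * U = 1\<^sub>m n \<and>
    diagonal_mat D \<and> H = U * D * mat_adjoint U"
  using assms
proof (induction n arbitrary: H)
  case 0
  then have "H = 1\<^sub>m 0 * H * mat_adjoint (1\<^sub>m 0)" by (intro eq_matI) auto
  with 0 show ?case
    by (intro exI [of _ "1\<^sub>m 0"] exI [of _ H]) (auto simp: diagonal_mat_def)
next
  case (Suc n)
  let ?m = "Suc n"
  note H = Suc.prems(1)
  note [simp] = carrier_matD [OF H]
  obtain e where "eigenvalue H e"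
    using spectrum_non_empty [OF H] by (auto simp: spectrum_def)
  then obtain v where v: "v \<in> carrier_vec ?m" "v \<noteq> 0\<^sub>v ?m" "H *\<^sub>v v = e \<cdot>\<^sub>v v"
    using H by (auto simp: eigenvalue_def eigenvector_def)
  obtain W c where W: "W \<in> carrier_mat ?m ?m" and WW: "mat_adjoint W * W = 1\<^sub>m ?m"
    and W0: "col W 0 = c \<cdot>\<^sub>v v"
    using unitary_with_first_col [OF v(1,2)] by blast
  note Wa = mat_adjoint_carrier [OF W] and [simp] = carrier_matD [OF W]
  have WW': "W * mat_adjoint W = 1\<^sub>m ?m"
    by (rule mat_mult_left_right_inverse [OF Wa W WW])
  define B where "B = mat_adjoint W * H * W"
  have B: "B \<in> carrier_mat ?m ?m" using W Wa H by (auto simp: B_def)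
  note [simp] = carrier_matD [OF B]
  have HB: "H = W * B * mat_adjoint W"
  proof -
    have "W * B * mat_adjoint W = (W * mat_adjoint W) * H * (W * mat_adjoint W)"
      unfolding B_def using W Wa H by (simp add: assoc_mult_mat_dim)
    then show ?thesis using H by (simp add: WW')
  qed
  have Bh: "mat_adjoint B = B"
    unfolding B_def using W Wa H Suc.prems(2)
    by (simp add: mat_adjoint_mult assoc_mult_mat_dim)
  have B0: "B $$ (i, 0) = (if i = 0 then e else 0)" if i: "i < ?m" for i
  proof -
    have "H *\<^sub>v col W 0 = e \<cdot>\<^sub>v col W 0"
      using v H by (simp add: W0 mult_mat_vec smult_smult_assoc mult.commute)
    moreover have "col (H * W) 0 = H *\<^sub>v col W 0"
      by (rule col_mult2 [OF H W]) simp
    ultimately have "col (H * W) 0 = e \<cdot>\<^sub>v col W 0" by simp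
    then have "B $$ (i, 0) = row (mat_adjoint W) i \<bullet> (e \<cdot>\<^sub>v col W 0)"
      unfolding B_def using i W Wa H by (simp add: assoc_mult_mat_dim)
    also have "\<dots> = e * (mat_adjoint W * W) $$ (i, 0)"
      using i W Wa by (simp add: scalar_prod_smult_distrib [of _ ?m])
    finally show ?thesis using i by (simp add: WW)
  qed
  \<comment> \<open>Hermitian symmetry carries the zeros of the first column over to the first row;
    the corner entry is read off from \<open>B0\<close>.\<close>
  have B0': "B $$ (0, j) = (if j = 0 then e else 0)" if j: "j < ?m" for j
  proof (cases "j = 0")
    case False
    have "B $$ (0, j) = mat_adjoint B $$ (0, j)" by (simp add: Bh)
    also have "\<dots> = conjugate (B $$ (j, 0))" using j B by simp
    finally show ?thesis using B0 j False by simp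
  qed (use B0 in auto)
  define C where "C = mat n n (\<lambda>(i, j). B $$ (Suc i, Suc j))"
  define E where "E = mat 1 1 (\<lambda>_. e)"
  have C: "C \<in> carrier_mat n n" and E: "E \<in> carrier_mat 1 1" by (simp_all add: C_def E_def)
  have BC: "B = four_block_mat E (0\<^sub>m 1 n) (0\<^sub>m n 1) C"
    using B B0 B0' by (intro eq_matI) (auto simp: C_def E_def)
  have "mat_adjoint C = C"
  proof (rule eq_matI)
    fix i j assume ij: "i < dim_row C" "j < dim_col C"
    then have "mat_adjoint C $$ (i, j) = mat_adjoint B $$ (Suc i, Suc j)"
      using B by (simp add: C_def)
    then show "mat_adjoint C $$ (i, j) = C $$ (i, j)" using ij by (simp add: Bh C_def)
  qed (auto simp: C_def)
  then obtain V D where V: "V \<in> carrier_mat n n" and D: "D \<in> carrier_mat n n"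
    and VV: "mat_adjoint V * V = 1\<^sub>m n" and diag: "diagonal_mat D" and CV: "C = V * D * mat_adjoint V"
    using Suc.IH [OF C] by blast
  define V1 where "V1 = four_block_mat (1\<^sub>m 1) (0\<^sub>m 1 n) (0\<^sub>m n 1) V"
  define D1 where "D1 = four_block_mat E (0\<^sub>m 1 n) (0\<^sub>m n 1) D"
  have V1: "V1 \<in> carrier_mat ?m ?m" and D1: "D1 \<in> carrier_mat ?m ?m"
    using V D E by (auto simp: V1_def D1_def)
  note V1a = mat_adjoint_carrier [OF V1] and [simp] = carrier_matD [OF V1] carrier_matD [OF D1]
  have V1adj: "mat_adjoint V1 = four_block_mat (1\<^sub>m 1) (0\<^sub>m 1 n) (0\<^sub>m n 1) (mat_adjoint V)"
    unfolding V1_def using V by (simp add: mat_adjoint_four_block_diag del: One_nat_def)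
  have "mat_adjoint V1 * V1 = four_block_mat (1\<^sub>m 1) (0\<^sub>m 1 n) (0\<^sub>m n 1) (1\<^sub>m n)"
    unfolding V1adj using V by (simp add: V1_def four_block_diag_mult VV del: One_nat_def)
  then have VV1: "mat_adjoint V1 * V1 = 1\<^sub>m ?m" by simp
  have BV: "B = V1 * D1 * mat_adjoint V1"
    unfolding V1adj unfolding BC V1_def D1_def using V D E
    by (simp add: four_block_diag_mult [of _ 1 _ n] CV del: One_nat_def)
  show ?case
  proof (intro exI conjI)
    show "W * V1 \<in> carrier_mat ?m ?m" "D1 \<in> carrier_mat ?m ?m" using W V1 D1 by auto
    have "mat_adjoint (W * V1) * (W * V1) = mat_adjoint V1 * (mat_adjoint W * W) * V1"
      using W Wa V1 V1a by (simp add: mat_adjoint_mult assoc_mult_mat_dim)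
    then show "mat_adjoint (W * V1) * (W * V1) = 1\<^sub>m ?m" using V1a by (simp add: WW VV1)
    show "H = W * V1 * D1 * mat_adjoint (W * V1)"
      using W Wa V1 V1a D1 by (simp add: HB BV mat_adjoint_mult assoc_mult_mat_dim)
    show "diagonal_mat D1"
      using diag D E by (auto simp: diagonal_mat_def D1_def)
  qed
qed

section \<open>Truncated singular value decomposition\<close>

text \<open>The identity between the squared length of X w and the Gram form w* X* X w. A unitary
  \<open>X\<close> turns it into isometry, and a matrix whose columns diagonalize the Gram form
  turns it into a weighted sum of squares.\<close>

lemma sum_cmod_mult_eq_adjoint:
  fixes X :: "complex mat"
  assumes X: "X \<in> carrier_mat m n" and w: "w \<in> carrier_vec n"
  shows "complex_of_real (\<Sum>i<m. (cmod ((X *\<^sub>v w) $ i))\<^sup>2) =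
    (\<Sum>j<n. cnj (w $ j) * ((mat_adjoint X * X) *\<^sub>v w) $ j)"
proof -
  have "complex_of_real (\<Sum>i<m. (cmod ((X *\<^sub>v w) $ i))\<^sup>2) =
      (\<Sum>i<m. cnj ((X *\<^sub>v w) $ i) * (X *\<^sub>v w) $ i)"
    unfolding of_real_sum complex_norm_square by (simp add: mult.commute)
  also have "\<dots> = (\<Sum>i<m. \<Sum>j<n. cnj (w $ j) * (cnj (X $$ (i, j)) * (X *\<^sub>v w) $ i))"
  proof (rule sum.cong [OF refl])
    fix i assume "i \<in> {..<m}"
    then have "(X *\<^sub>v w) $ i = (\<Sum>j<n. X $$ (i, j) * w $ j)"
      using X w by (auto simp: scalar_prod_def lessThan_atLeast0 intro!: sum.cong)
    then have "cnj ((X *\<^sub>v w) $ i) = (\<Sum>j<n. cnj (w $ j) * cnj (X $$ (i, j)))"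
      by (simp add: mult.commute)
    then show "cnj ((X *\<^sub>v w) $ i) * (X *\<^sub>v w) $ i =
        (\<Sum>j<n. cnj (w $ j) * (cnj (X $$ (i, j)) * (X *\<^sub>v w) $ i))"
      by (simp only: sum_distrib_right mult.assoc)
  qed
  also have "\<dots> = (\<Sum>j<n. \<Sum>i<m. cnj (w $ j) * (cnj (X $$ (i, j)) * (X *\<^sub>v w) $ i))"
    by (rule sum.swap)
  also have "\<dots> = (\<Sum>j<n. cnj (w $ j) * (mat_adjoint X *\<^sub>v (X *\<^sub>v w)) $ j)"
  proof (rule sum.cong [OF refl])
    fix j assume "j \<in> {..<n}"
    then have "(mat_adjoint X *\<^sub>v (X *\<^sub>v w)) $ j = (\<Sum>i<m. cnj (X $$ (i, j)) * (X *\<^sub>v w) $ i)"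
      using X by (auto simp: scalar_prod_def [of _ "X *\<^sub>v w"] lessThan_atLeast0 intro!: sum.cong)
    then show "(\<Sum>i<m. cnj (w $ j) * (cnj (X $$ (i, j)) * (X *\<^sub>v w) $ i)) =
        cnj (w $ j) * (mat_adjoint X *\<^sub>v (X *\<^sub>v w)) $ j"
      by (simp add: sum_distrib_left)
  qed
  finally show ?thesis
    using X w by (simp add: assoc_mult_mat_vec [of _ n m _ n])
qed

lemma sum_cmod_unitary:
  fixes U :: "complex mat"
  assumes U: "U \<in> carrier_mat n n" "mat_adjoint U * U = 1\<^sub>m n" and w: "w \<in> carrier_vec n"
  shows "(\<Sum>i<n. (cmod ((U *\<^sub>v w) $ i))\<^sup>2) = (\<Sum>i<n. (cmod (w $ i))\<^sup>2)"
proof -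
  have "complex_of_real (\<Sum>i<n. (cmod ((U *\<^sub>v w) $ i))\<^sup>2) = (\<Sum>i<n. cnj (w $ i) * w $ i)"
    using sum_cmod_mult_eq_adjoint [OF U(1) w] w by (simp add: U(2))
  also have "\<dots> = complex_of_real (\<Sum>i<n. (cmod (w $ i))\<^sup>2)"
    unfolding of_real_sum complex_norm_square by (simp add: mult.commute)
  finally show ?thesis using of_real_eq_iff by blast
qed

text \<open>The columns of \<open>X * U\<close> are orthogonal, and the diagonal of \<open>D\<close>
  holds their squared lengths; the last conclusion is Pythagoras for them. Similarity of
  \<open>D\<close> to the Gram matrix identifies this diagonal, with multiplicities, with the roots
  that define the singular values.\<close>

lemma gram_unitary_diagonalization:
  fixes X :: "complex mat"
  assumes X: "X \<in> carrier_mat m n"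
  obtains U D where "U \<in> carrier_mat n n" "D \<in> carrier_mat n n" "mat_adjoint U * U = 1\<^sub>m n"
    "U * mat_adjoint U = 1\<^sub>m n" "diagonal_mat D" "mat_adjoint X * X = U * D * mat_adjoint U"
    "proots (char_poly (mat_adjoint X * X)) = mset (diag_mat D)"
    "\<And>w. w \<in> carrier_vec n \<Longrightarrow>
      (\<Sum>i<m. (cmod ((X *\<^sub>v (U *\<^sub>v w)) $ i))\<^sup>2) = (\<Sum>j<n. Re (D $$ (j, j)) * (cmod (w $ j))\<^sup>2)"
proof -
  let ?H = "mat_adjoint X * X"
  have H: "?H \<in> carrier_mat n n" "mat_adjoint ?H = ?H"
    using X by (auto simp: mat_adjoint_mult)
  obtain U D where U: "U \<in> carrier_mat n n" and D: "D \<in> carrier_mat n n" and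
    UU: "mat_adjoint U * U = 1\<^sub>m n"
    and diag: "diagonal_mat D" and HU: "?H = U * D * mat_adjoint U"
    using hermitian_unitary_diagonalization [OF H] by blast
  note Ua = mat_adjoint_carrier [OF U]
  note [simp] = carrier_matD [OF X] carrier_matD [OF U] carrier_matD [OF D]
  have UU': "U * mat_adjoint U = 1\<^sub>m n" by (rule mat_mult_left_right_inverse [OF Ua U UU])
  have "similar_mat ?H D"
  proof (rule similar_matI)
    show "{?H, D, U, mat_adjoint U} \<subseteq> carrier_mat n n" using H(1) U Ua D by blast
    show "U * mat_adjoint U = 1\<^sub>m n" by (rule UU')
    show "mat_adjoint U * U = 1\<^sub>m n" by (rule UU)
    show "?H = U * D * mat_adjoint U" by (rule HU)
  qed
  then have "char_poly ?H = char_poly D" by (rule char_poly_similar)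
  also have "\<dots> = (\<Prod>a\<leftarrow>diag_mat D. [:- a, 1:])"
    by (rule char_poly_upper_triangular [OF D])
      (use diag D in \<open>simp add: diagonal_mat_def upper_triangular_def\<close>)
  finally have cp: "char_poly ?H = (\<Prod>a\<leftarrow>diag_mat D. [:- a, 1:])" .
  have "proots (\<Prod>a\<leftarrow>as. [:- a, 1:]) = mset as" for as :: "complex list"
  proof (induction as)
    case (Cons a as)
    have "(\<Prod>a\<leftarrow>as. [:- a, 1:]) \<noteq> 0" by (auto simp: prod_list_zero_iff)
    then show ?case using Cons by (simp add: proots_mult del: mult_pCons_left)
  qed simp
  then have pr: "proots (char_poly ?H) = mset (diag_mat D)" by (simp add: cp)
  have norm: "(\<Sum>i<m. (cmod ((X *\<^sub>v (U *\<^sub>v w)) $ i))\<^sup>2) = (\<Sum>j<n. Re (D $$ (j, j)) * (cmod (w $ j))\<^sup>2)"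
    if w: "w \<in> carrier_vec n" for w
  proof -
    have XU: "X * U \<in> carrier_mat m n" using X U by auto
    have "mat_adjoint (X * U) * (X * U) = mat_adjoint U * ?H * U"
      using X U Ua mat_adjoint_carrier [OF X] by (simp add: mat_adjoint_mult assoc_mult_mat_dim)
    also have "\<dots> = (mat_adjoint U * U) * D * (mat_adjoint U * U)"
      unfolding HU using U Ua D by (simp add: assoc_mult_mat_dim)
    also have "\<dots> = D" using D by (simp add: UU)
    finally have G: "mat_adjoint (X * U) * (X * U) = D" .
    have Dw: "(D *\<^sub>v w) $ j = D $$ (j, j) * w $ j" if j: "j < n" for j
    proof -
      have "(D *\<^sub>v w) $ j = (\<Sum>k<n. D $$ (j, k) * w $ k)"
        using D w j by (auto simp: scalar_prod_def lessThan_atLeast0 intro!: sum.cong)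
      also have "\<dots> = (\<Sum>k<n. if k = j then D $$ (j, j) * w $ j else 0)"
        using D j diag by (intro sum.cong) (auto simp: diagonal_mat_def)
      finally show ?thesis using j by simp
    qed
    have "complex_of_real (\<Sum>i<m. (cmod ((X *\<^sub>v (U *\<^sub>v w)) $ i))\<^sup>2)
        = (\<Sum>j<n. cnj (w $ j) * (D *\<^sub>v w) $ j)"
      using sum_cmod_mult_eq_adjoint [OF XU w] X U w by (simp add: G assoc_mult_mat_vec [of X m n U n])
    also have "\<dots> = (\<Sum>j<n. D $$ (j, j) * complex_of_real ((cmod (w $ j))\<^sup>2))"
      by (intro sum.cong)
        (auto simp: Dw complex_norm_square mult_ac simp del: of_real_power index_mult_mat_vec)
    \<comment> \<open>The left side is real, so passing to real parts loses nothing there and leaves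
      only the real parts of the entries of \<open>D\<close>.\<close>
    finally have "Re (complex_of_real (\<Sum>i<m. (cmod ((X *\<^sub>v (U *\<^sub>v w)) $ i))\<^sup>2)) =
        Re (\<Sum>j<n. D $$ (j, j) * complex_of_real ((cmod (w $ j))\<^sup>2))" by (rule arg_cong)
    then show ?thesis by (simp del: of_real_power)
  qed
  show ?thesis by (rule that [OF U D UU UU' diag HU pr norm])
qed

text \<open>In a nonincreasing list the entries above \<open>M\<close> form a prefix.\<close>

lemma sorted_desc_nth_greater:
  fixes xs :: "real list"
  assumes "sorted_wrt (\<ge>) xs" "i < length (filter (\<lambda>x. x > M) xs)"
  shows "xs ! i > M"
  using assms
proof (induction xs arbitrary: i)
  case (Cons x xs)
  show ?case
  proof (cases "x > M")
    case True
    then show ?thesis using Cons by (cases i) auto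
  next
    case False
    then have "filter (\<lambda>x. x > M) (x # xs) = []"
      using Cons.prems(1) by (auto simp: filter_empty_conv)
    with Cons.prems(2) show ?thesis by (metis length_0_conv not_less_zero)
  qed
qed simp

text \<open>Only a lower bound is claimed: eigenvalues dropped from the list of singular values are not
  shown to vanish, but the rank of a matrix is bounded by its dimensions anyway.\<close>

lemma card_singular_value_greater:
  assumes "proots (char_poly (mat_adjoint X * X)) = mset es" "M \<ge> 0"
  shows "min (min (dim_row X) (dim_col X)) (length (filter (\<lambda>z. Re z > M\<^sup>2) es))
    \<le> card {i \<in> {1..min (dim_row X) (dim_col X)}. singular_value X i > M}"
proof -
  let ?q = "min (dim_row X) (dim_col X)" and ?k = "length (filter (\<lambda>z. Re z > M\<^sup>2) es)"
  define xs where "xs = rev (sorted_list_of_multiset (image_mset (\<lambda>z. sqrt (Re z)) (mset es)))"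
  have mset: "mset xs = image_mset (\<lambda>z. sqrt (Re z)) (mset es)" by (simp add: xs_def)
  have "sorted_wrt (\<ge>) xs" by (simp add: xs_def sorted_wrt_rev sorted_sorted_list_of_multiset)
  have "length (filter (\<lambda>x. x > M) xs) = size (filter_mset (\<lambda>x. x > M) (mset xs))"
    by (metis mset_filter size_mset)
  also have "\<dots> = size (filter_mset (\<lambda>z. sqrt (Re z) > M) (mset es))"
    by (simp add: mset filter_mset_image_mset)
  \<comment> \<open>The real \<open>sqrt\<close> is odd and strictly increasing on all of the reals,
    so the equivalence also covers a negative \<open>Re z\<close>.\<close>
  also have "(\<lambda>z. sqrt (Re z) > M) = (\<lambda>z. Re z > M\<^sup>2)"
    using assms(2) by (auto simp: fun_eq_iff simp flip: real_sqrt_less_iff [of "M\<^sup>2"])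
  finally have len: "length (filter (\<lambda>x. x > M) xs) = ?k" by (metis mset_filter size_mset)
  have "{1..min ?q ?k} \<subseteq> {i \<in> {1..?q}. singular_value X i > M}"
  proof
    fix i assume i: "i \<in> {1..min ?q ?k}"
    then have "i - 1 < length (filter (\<lambda>x. x > M) xs)" by (auto simp: len)
    then have "xs ! (i - 1) > M" using \<open>sorted_wrt (\<ge>) xs\<close> by (intro sorted_desc_nth_greater)
    moreover have "singular_value X i = xs ! (i - 1)"
      unfolding singular_value_def singular_values_def assms(1) xs_def
      using i by (intro nth_take) auto
    ultimately show "i \<in> {i \<in> {1..?q}. singular_value X i > M}" using i by auto
  qed
  from card_mono [OF _ this] show ?thesis by simp
qed

text \<open>With \<open>Y = X * U\<close>, the matrix \<open>X\<close> is the sum of the dyads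
  formed by column j of \<open>Y\<close> and the conjugate of column j of \<open>U\<close>. The
  dyads with eigenvalue above \<open>M\<^sup>2\<close> form \<open>R\<close>, the others
  \<open>N\<close>; the square appears because the eigenvalues are squared singular values.\<close>

lemma truncated_svd:
  assumes M: "M \<ge> 0"
  obtains R N where "R \<in> carrier_mat (dim_row X) (dim_col X)" "N \<in> carrier_mat (dim_row X) (dim_col X)"
    "X = R + N"
    "rank_le (card {i \<in> {1..min (dim_row X) (dim_col X)}. singular_value X i > M}) R"
    "opnorm_le M N"
proof -
  define m n where "m = dim_row X" and "n = dim_col X"
  have X: "X \<in> carrier_mat m n" by (simp add: m_def n_def)
  obtain U D where U: "U \<in> carrier_mat n n" and D: "D \<in> carrier_mat n n" and
    UU: "mat_adjoint U * U = 1\<^sub>m n"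
    "U * mat_adjoint U = 1\<^sub>m n" and pr: "proots (char_poly (mat_adjoint X * X)) = mset (diag_mat D)"
    and norm: "\<And>w. w \<in> carrier_vec n \<Longrightarrow>
      (\<Sum>i<m. (cmod ((X *\<^sub>v (U *\<^sub>v w)) $ i))\<^sup>2) = (\<Sum>j<n. Re (D $$ (j, j)) * (cmod (w $ j))\<^sup>2)"
    by (rule gram_unitary_diagonalization [OF X]) (rule that)
  note Ua = mat_adjoint_carrier [OF U]
  note [simp] = carrier_matD [OF X] carrier_matD [OF U] carrier_matD [OF D]
  define Y where "Y = X * U"
  have Y: "Y \<in> carrier_mat m n" using X U by (auto simp: Y_def)
  define L where "L = {j. j < n \<and> Re (D $$ (j, j)) > M\<^sup>2}"
  define part where "part S = mat m n (\<lambda>(i, k). \<Sum>j\<in>S. Y $$ (i, j) * cnj (U $$ (k, j)))" for S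
  have finL: "finite L" "L \<subseteq> {..<n}" by (auto simp: L_def)
  have part: "part S \<in> carrier_mat m n" for S by (simp add: part_def)
  have "X = part {..<n}"
  proof -
    have "X = X * (U * mat_adjoint U)" using X by (simp add: UU(2))
    also have "\<dots> = Y * mat_adjoint U"
      unfolding Y_def by (rule assoc_mult_mat [OF X U Ua, symmetric])
    also have "\<dots> = part {..<n}"
      using Y U by (intro eq_matI)
        (auto simp: part_def scalar_prod_def lessThan_atLeast0 intro!: sum.cong)
    finally show ?thesis .
  qed
  also have "\<dots> = part L + part ({..<n} - L)"
    using finL by (auto simp: part_def sum.subset_diff [of L "{..<n}"])
  finally have split: "X = part L + part ({..<n} - L)" .
  have "rank_le (card L) (part L)"
    by (rule rank_le_sum [OF finL(1), where y = "\<lambda>i j. Y $$ (i, j)" and z = "\<lambda>j k. cnj (U $$ (k, j))"])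
      (simp add: part_def)
  moreover have "rank_le (min m n) (part L)"
    using rank_le_dims [of "part L"] by (simp add: part_def)
  \<comment> \<open>Both bounds are combined because \<open>card_singular_value_greater\<close>
    compares exactly this minimum with the number of large singular values.\<close>
  ultimately have "rank_le (min (min m n) (card L)) (part L)" by (simp add: min_def)
  moreover have "card L = length (filter (\<lambda>z. Re z > M\<^sup>2) (diag_mat D))"
  proof -
    have "card L = length (filter (\<lambda>j. Re (D $$ (j, j)) > M\<^sup>2) [0..<n])"
      by (auto simp: length_filter_conv_card L_def intro!: arg_cong [where f = card])
    then show ?thesis using D by (simp add: diag_mat_def filter_map o_def)
  qed
  ultimately have rank: "rank_le (card {i \<in> {1..min m n}. singular_value X i > M}) (part L)"
    using rank_le_mono card_singular_value_greater [OF pr M] by simp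
  have "opnorm_le M (part ({..<n} - L))"
    unfolding opnorm_le_def
  proof (intro conjI allI M)
    fix v :: "nat \<Rightarrow> complex"
    define u where "u = mat_adjoint U *\<^sub>v vec n v"
    have u: "u \<in> carrier_vec n" using Ua by (simp add: u_def)
    \<comment> \<open>Erasing the coordinates of \<open>u\<close> in \<open>L\<close> makes the
      remainder act on \<open>v\<close> as \<open>X * U\<close> acts on \<open>w\<close>.\<close>
    define w where "w = vec n (\<lambda>j. if j \<in> L then 0 else u $ j)"
    have w: "w \<in> carrier_vec n" by (simp add: w_def)
    have uj: "u $ j = (\<Sum>k<n. cnj (U $$ (k, j)) * v k)" if "j < n" for j
      using that U by (auto simp: u_def scalar_prod_def lessThan_atLeast0 intro!: sum.cong)
    have entry: "(\<Sum>k<n. part ({..<n} - L) $$ (i, k) * v k) = (X *\<^sub>v (U *\<^sub>v w)) $ i" if i: "i < m" for i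
    proof -
      have "(\<Sum>k<n. part ({..<n} - L) $$ (i, k) * v k) =
          (\<Sum>k<n. \<Sum>j\<in>{..<n} - L. Y $$ (i, j) * (cnj (U $$ (k, j)) * v k))"
        using i by (simp add: part_def sum_distrib_right mult.assoc)
      also have "\<dots> = (\<Sum>j\<in>{..<n} - L. \<Sum>k<n. Y $$ (i, j) * (cnj (U $$ (k, j)) * v k))"
        by (rule sum.swap)
      also have "\<dots> = (\<Sum>j\<in>{..<n} - L. Y $$ (i, j) * u $ j)"
        by (intro sum.cong) (auto simp: uj sum_distrib_left)
      also have "\<dots> = (\<Sum>j<n. Y $$ (i, j) * w $ j)"
        by (intro sum.mono_neutral_cong_left) (auto simp: w_def)
      also have "\<dots> = (Y *\<^sub>v w) $ i"
        using i Y w by (auto simp: scalar_prod_def lessThan_atLeast0 intro!: sum.cong)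
      finally show ?thesis unfolding Y_def using assoc_mult_mat_vec [OF X U w] by simp
    qed
    have "(\<Sum>i<m. (cmod (\<Sum>k<n. part ({..<n} - L) $$ (i, k) * v k))\<^sup>2) =
        (\<Sum>j<n. Re (D $$ (j, j)) * (cmod (w $ j))\<^sup>2)"
      using entry norm [OF w] by simp
    \<comment> \<open>On \<open>L\<close> the coordinates of \<open>w\<close> vanish; elsewhere the
      eigenvalue is at most \<open>M\<^sup>2\<close>.\<close>
    also have "\<dots> \<le> (\<Sum>j<n. M\<^sup>2 * (cmod (u $ j))\<^sup>2)"
      by (intro sum_mono) (auto simp: w_def L_def intro!: mult_right_mono)
    also have "\<dots> = M\<^sup>2 * (\<Sum>j<n. (cmod (vec n v $ j))\<^sup>2)"
      using sum_cmod_unitary [OF Ua, of "vec n v"] UU(2) by (simp add: u_def sum_distrib_left [symmetric])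
    finally show "(\<Sum>i<dim_row (part ({..<n} - L)). (cmod (\<Sum>j<dim_col (part ({..<n} - L)).
        part ({..<n} - L) $$ (i, j) * v j))\<^sup>2)
      \<le> M\<^sup>2 * (\<Sum>j<dim_col (part ({..<n} - L)). (cmod (v j))\<^sup>2)"
      using part by (simp add: part_def)
  qed
  with part [of L] part [of "{..<n} - L"] split rank show ?thesis
    unfolding m_def n_def by (rule that)
qed

section \<open>Approximating classes of sequences\<close>

text \<open>Here \<open>\<rho>\<close> bounds the rank relative to the smaller dimension. Applied to
  \<open>A\<close> with a large \<open>C\<close> this expresses near boundedness, applied to
  \<open>A - B\<close> with a small \<open>C\<close> it expresses closeness.\<close>

definition low_rank_plus_small :: "real \<Rightarrow> real \<Rightarrow> complex mat \<Rightarrow> bool" where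
  "low_rank_plus_small \<rho> C Z \<longleftrightarrow> (\<exists>R N. R \<in> carrier_mat (dim_row Z) (dim_col Z) \<and>
     N \<in> carrier_mat (dim_row Z) (dim_col Z) \<and> Z = R + N \<and>
     real (mat_rank R) \<le> \<rho> * real (min (dim_row Z) (dim_col Z)) \<and> opnorm_le C N)"

lemma low_rank_plus_smallE:
  assumes "low_rank_plus_small \<rho> C Z" "Z \<in> carrier_mat m n"
  obtains R N k where "R \<in> carrier_mat m n" "N \<in> carrier_mat m n" "Z = R + N"
    "rank_le k R" "real k \<le> \<rho> * real (min m n)" "opnorm_le C N"
  using assms rank_le_mat_rank unfolding low_rank_plus_small_def by auto

lemma low_rank_plus_smallI:
  assumes "R \<in> carrier_mat (dim_row Z) (dim_col Z)"
    "N \<in> carrier_mat (dim_row Z) (dim_col Z)" "Z = R + N"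
    and "rank_le k R" "real k \<le> \<rho> * real (min (dim_row Z) (dim_col Z))" "opnorm_le C N"
  shows "low_rank_plus_small \<rho> C Z"
proof -
  have "real (mat_rank R) \<le> real k" using mat_rank_le [OF assms(4)] by simp
  also note assms(5)
  finally show ?thesis using assms unfolding low_rank_plus_small_def by blast
qed

lemma low_rank_plus_small_mono:
  assumes "low_rank_plus_small \<rho> C Z" "\<rho> \<le> \<rho>'" "C \<le> C'"
  shows "low_rank_plus_small \<rho>' C' Z"
proof -
  obtain R N k where d: "R \<in> carrier_mat (dim_row Z) (dim_col Z)"
    "N \<in> carrier_mat (dim_row Z) (dim_col Z)" "Z = R + N"
    "rank_le k R" "real k \<le> \<rho> * real (min (dim_row Z) (dim_col Z))" "opnorm_le C N"
    using low_rank_plus_smallE [OF assms(1)] by blast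
  note d(5)
  also have "\<rho> * real (min (dim_row Z) (dim_col Z)) \<le> \<rho>' * real (min (dim_row Z) (dim_col Z))"
    using assms(2) by (intro mult_right_mono) auto
  finally show ?thesis
    using d(1-4) opnorm_le_mono [OF d(6) assms(3)] by (intro low_rank_plus_smallI)
qed

lemma min_mult_min_le: "min m n * min m' n' \<le> min (m * m') (n * (n' :: nat))"
  by (intro min.boundedI mult_le_mono) auto

text \<open>In \<open>R \<otimes> A' + N \<otimes> R' + N \<otimes> N'\<close> the first two terms
  have a low-rank factor; the other factor, whatever its norm, costs at most its full rank.\<close>

lemma low_rank_plus_small_kron:
  assumes A: "low_rank_plus_small \<rho> C A" and A': "low_rank_plus_small \<rho>' C' A'"
    and "0 \<le> \<rho>" "0 \<le> \<rho>'"
  shows "low_rank_plus_small (\<rho> + \<rho>') (C * C') (kron A A')"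
proof -
  define m n m' n' where "m = dim_row A" and "n = dim_col A" and "m' = dim_row A'" and "n' = dim_col A'"
  have mn: "A \<in> carrier_mat m n" "A' \<in> carrier_mat m' n'"
    by (auto simp: m_def n_def m'_def n'_def)
  obtain R N k where d: "R \<in> carrier_mat m n" "N \<in> carrier_mat m n" "A = R + N"
    "rank_le k R" "real k \<le> \<rho> * real (min m n)" "opnorm_le C N"
    using low_rank_plus_smallE [OF A mn(1)] by blast
  obtain R' N' k' where d': "R' \<in> carrier_mat m' n'" "N' \<in> carrier_mat m' n'" "A' = R' + N'"
    "rank_le k' R'" "real k' \<le> \<rho>' * real (min m' n')" "opnorm_le C' N'"
    using low_rank_plus_smallE [OF A' mn(2)] by blast
  note dims = carrier_matD [OF d(1)] carrier_matD [OF d(2)]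
    carrier_matD [OF d'(1)] carrier_matD [OF d'(2)]
  show ?thesis
  proof (rule low_rank_plus_smallI)
    show "kron A A' = (kron R A' + kron N R') + kron N N'"
      unfolding d(3) d'(3) by (rule eq_matI) (auto simp: dims div_mod_less algebra_simps)
    have "rank_le (min m' n') A'" using rank_le_dims [of A'] by (simp add: m'_def n'_def)
    moreover have "rank_le (min m n) N" using rank_le_dims [of N] by (simp add: dims)
    ultimately show "rank_le (k * min m' n' + min m n * k') (kron R A' + kron N R')"
      using d(4) d'(4) by (intro rank_le_add rank_le_kron) (simp_all add: dims d'(3))
    show "opnorm_le (C * C') (kron N N')" by (rule opnorm_le_kron [OF d(6) d'(6)])
    have "real (k * min m' n' + min m n * k') \<le>
        (\<rho> * real (min m n)) * real (min m' n') + real (min m n) * (\<rho>' * real (min m' n'))"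
      using d(5) d'(5) by (simp only: of_nat_add of_nat_mult) (intro add_mono mult_mono, auto)
    also have "\<dots> = (\<rho> + \<rho>') * real (min m n * min m' n')"
      by (simp add: algebra_simps)
    also have "\<dots> \<le> (\<rho> + \<rho>') * real (min (m * m') (n * n'))"
      using assms(3,4) min_mult_min_le by (intro mult_left_mono)
        (simp_all only: of_nat_le_iff add_nonneg_nonneg)
    finally show "real (k * min m' n' + min m n * k') \<le>
        (\<rho> + \<rho>') * real (min (dim_row (kron A A')) (dim_col (kron A A')))"
      by (simp add: m_def n_def m'_def n'_def)
  qed (auto simp: dims d(3) d'(3) intro!: carrier_matI)
qed

text \<open>The norm bound is read off from \<open>N \<otimes> S'\<close> and
  \<open>(S - N) \<otimes> N'\<close>; the factor \<open>C + \<epsilon>\<close> bounds the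
  non-low-rank part \<open>S - N\<close> of \<open>B\<close>.\<close>

lemma low_rank_plus_small_kron_diff:
  assumes A: "low_rank_plus_small \<rho> C A" and A': "low_rank_plus_small \<rho>' C' A'"
    and AB: "low_rank_plus_small \<delta> \<epsilon> (A - B)" and AB': "low_rank_plus_small \<delta>' \<epsilon>' (A' - B')"
    and B: "B \<in> carrier_mat (dim_row A) (dim_col A)"
      and B': "B' \<in> carrier_mat (dim_row A') (dim_col A')"
    and nonneg: "0 \<le> \<rho>" "0 \<le> \<rho>'" "0 \<le> \<delta>" "0 \<le> \<delta>'"
  shows "low_rank_plus_small (\<rho> + \<rho>' + \<delta> + \<delta>') (\<epsilon> * C' + (C + \<epsilon>) * \<epsilon>') (kron A A' - kron B B')"
proof -
  define m n m' n' where "m = dim_row A" and "n = dim_col A" and "m' = dim_row A'" and "n' = dim_col A'"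
  have mn: "B \<in> carrier_mat m n" "A \<in> carrier_mat m n" "B' \<in> carrier_mat m' n'" "A' \<in> carrier_mat m' n'"
    using B B' by (auto simp: m_def n_def m'_def n'_def)
  obtain P S h where d: "P \<in> carrier_mat m n" "S \<in> carrier_mat m n" "A = P + S"
    "rank_le h P" "real h \<le> \<rho> * real (min m n)" "opnorm_le C S"
    using low_rank_plus_smallE [OF A mn(2)] by blast
  obtain P' S' h' where d': "P' \<in> carrier_mat m' n'" "S' \<in> carrier_mat m' n'" "A' = P' + S'"
    "rank_le h' P'" "real h' \<le> \<rho>' * real (min m' n')" "opnorm_le C' S'"
    using low_rank_plus_smallE [OF A' mn(4)] by blast
  obtain R N k where e: "R \<in> carrier_mat m n" "N \<in> carrier_mat m n" "A - B = R + N"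
    "rank_le k R" "real k \<le> \<delta> * real (min m n)" "opnorm_le \<epsilon> N"
    using low_rank_plus_smallE [OF AB minus_carrier_mat [OF mn(1)]] by blast
  obtain R' N' k' where e': "R' \<in> carrier_mat m' n'" "N' \<in> carrier_mat m' n'" "A' - B' = R' + N'"
    "rank_le k' R'" "real k' \<le> \<delta>' * real (min m' n')" "opnorm_le \<epsilon>' N'"
    using low_rank_plus_smallE [OF AB' minus_carrier_mat [OF mn(3)]] by blast
  note dims = mn [THEN carrier_matD(1)] mn [THEN carrier_matD(2)]
    d(1,2) [THEN carrier_matD(1)] d(1,2) [THEN carrier_matD(2)]
    d'(1,2) [THEN carrier_matD(1)] d'(1,2) [THEN carrier_matD(2)]
    e(1,2) [THEN carrier_matD(1)] e(1,2) [THEN carrier_matD(2)]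
    e'(1,2) [THEN carrier_matD(1)] e'(1,2) [THEN carrier_matD(2)]
  have ent: "A $$ (i, j) = P $$ (i, j) + S $$ (i, j)"
    "B $$ (i, j) = P $$ (i, j) + S $$ (i, j) - R $$ (i, j) - N $$ (i, j)" if "i < m" "j < n" for i j
  proof -
    show a: "A $$ (i, j) = P $$ (i, j) + S $$ (i, j)" using that dims by (simp add: d(3))
    have "(A - B) $$ (i, j) = (R + N) $$ (i, j)" by (simp add: e(3))
    then show "B $$ (i, j) = P $$ (i, j) + S $$ (i, j) - R $$ (i, j) - N $$ (i, j)"
      using that by (simp add: dims a algebra_simps)
  qed
  have ent': "A' $$ (i, j) = P' $$ (i, j) + S' $$ (i, j)"
    "B' $$ (i, j) = P' $$ (i, j) + S' $$ (i, j) - R' $$ (i, j) - N' $$ (i, j)"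
    if "i < m'" "j < n'" for i j
  proof -
    show a: "A' $$ (i, j) = P' $$ (i, j) + S' $$ (i, j)" using that dims by (simp add: d'(3))
    have "(A' - B') $$ (i, j) = (R' + N') $$ (i, j)" by (simp add: e'(3))
    then show "B' $$ (i, j) = P' $$ (i, j) + S' $$ (i, j) - R' $$ (i, j) - N' $$ (i, j)"
      using that by (simp add: dims a algebra_simps)
  qed
  let ?q = "min m n" and ?q' = "min m' n'"
  \<comment> \<open>Expanding \<open>B \<otimes> N'\<close> produces
    \<open>- R \<otimes> N'\<close>; merged with \<open>R \<otimes> A'\<close> it gives the factor
    \<open>A' - N'\<close> and costs no further rank.\<close>
  let ?F = "kron R (A' - N') + kron N P' + kron B R' + kron P N'"
  let ?G = "kron N S' + kron (S + (- N)) N'"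
  have full: "rank_le ?q X" if "X \<in> carrier_mat m n" for X
    using rank_le_dims [of X] that by auto
  have full': "rank_le ?q' X" if "X \<in> carrier_mat m' n'" for X
    using rank_le_dims [of X] that by auto
  show ?thesis
  proof (rule low_rank_plus_smallI)
    \<comment> \<open>Expand \<open>(A - B) \<otimes> A' + B \<otimes> (A' - B')\<close> with \<open>B = P + S - R - N\<close>.\<close>
    show "kron A A' - kron B B' = ?F + ?G"
      by (rule eq_matI) (simp_all add: dims div_mod_less ent ent' algebra_simps)
    show "rank_le (k * ?q' + ?q * h' + ?q * k' + h * ?q') ?F"
      by (intro rank_le_add rank_le_kron full full' d(4) d'(4) e(4) e'(4)
        mn d(1,2) d'(1,2) e(1,2) e'(1,2) minus_carrier_mat)
        (simp_all add: dims)
    show "opnorm_le (\<epsilon> * C' + (C + \<epsilon>) * \<epsilon>') ?G"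
      by (intro opnorm_le_add opnorm_le_kron opnorm_le_uminus d(6) d'(6) e(6) e'(6))
        (simp_all add: dims)
    have "real (k * ?q' + ?q * h' + ?q * k' + h * ?q') \<le>
        (\<delta> * real ?q) * real ?q' + real ?q * (\<rho>' * real ?q') + real ?q * (\<delta>' * real ?q')
          + (\<rho> * real ?q) * real ?q'"
      using d(5) d'(5) e(5) e'(5) nonneg
      by (simp only: of_nat_add of_nat_mult) (intro add_mono mult_mono, auto)
    also have "\<dots> = (\<rho> + \<rho>' + \<delta> + \<delta>') * real (?q * ?q')"
      by (simp add: algebra_simps)
    also have "\<dots> \<le> (\<rho> + \<rho>' + \<delta> + \<delta>') * real (min (m * m') (n * n'))"
      using nonneg min_mult_min_le by (intro mult_left_mono)
        (simp_all only: of_nat_le_iff add_nonneg_nonneg)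
    finally show "real (k * ?q' + ?q * h' + ?q * k' + h * ?q') \<le> (\<rho> + \<rho>' + \<delta> + \<delta>') *
        real (min (dim_row (kron A A' - kron B B')) (dim_col (kron A A' - kron B B')))"
      by (simp add: dims)
    show "?F \<in> carrier_mat (dim_row (kron A A' - kron B B')) (dim_col (kron A A' - kron B B'))"
      "?G \<in> carrier_mat (dim_row (kron A A' - kron B B')) (dim_col (kron A A' - kron B B'))"
      by (rule carrier_matI; simp add: dims)+
  qed
qed

section \<open>Passage from single matrices to sequences\<close>

abbreviation along :: "nat set \<Rightarrow> nat filter" where
  "along I \<equiv> inf sequentially (principal I)"

lemma eventually_along:
  "eventually P (along I) \<longleftrightarrow> (\<exists>N. \<forall>n\<in>I. n \<ge> N \<longrightarrow> P n)"
  by (auto simp: eventually_inf_principal eventually_sequentially)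

text \<open>Sparse unboundedness in terms of splittings, with the threshold \<open>M\<close> itself
  as norm bound.\<close>

definition almost_bounded :: "nat set \<Rightarrow> (nat \<Rightarrow> complex mat) \<Rightarrow> bool" where
  "almost_bounded I A \<longleftrightarrow> (\<exists>r. (r \<longlongrightarrow> 0) at_top \<and>
     (\<forall>M>0. \<forall>\<^sub>F n in along I. low_rank_plus_small (r M) M (A n)))"

lemma sparsely_unbounded_imp_almost_bounded:
  assumes "sparsely_unbounded I A"
  shows "almost_bounded I A"
proof -
  obtain r where r: "(r \<longlongrightarrow> 0) at_top" and
    ev: "\<And>M. M > 0 \<Longrightarrow> \<forall>\<^sub>F n in along I.
          real (card {i \<in> {1..min (dim_row (A n)) (dim_col (A n))}. singular_value (A n) i > M})
            / real (min (dim_row (A n)) (dim_col (A n))) \<le> r M"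
    using assms unfolding sparsely_unbounded_def eventually_along by blast
  have "\<forall>\<^sub>F n in along I. low_rank_plus_small (r M) M (A n)" if M: "M > 0" for M
    using ev [OF M]
  proof eventually_elim
    case (elim n)
    let ?q = "min (dim_row (A n)) (dim_col (A n))"
    let ?k = "card {i \<in> {1..?q}. singular_value (A n) i > M}"
    have "real ?k \<le> r M * real ?q"
    \<comment> \<open>Division by zero yields 0, so for an empty matrix the quotient says nothing
      about the count; the index set is then empty.\<close>
    proof (cases "?q = 0")
      case True
      then have "{i \<in> {1..?q}. singular_value (A n) i > M} = {}" by auto
      then show ?thesis using True by simp
    next
      case False
      then show ?thesis using elim by (simp add: pos_divide_le_eq del: min_less_iff_conj of_nat_min)
    qed
    moreover obtain R N where "R \<in> carrier_mat (dim_row (A n)) (dim_col (A n))"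
      "N \<in> carrier_mat (dim_row (A n)) (dim_col (A n))" "A n = R + N" "rank_le ?k R" "opnorm_le M N"
      using truncated_svd [OF less_imp_le [OF M]] by blast
    ultimately show ?case by (intro low_rank_plus_smallI)
  qed
  with r show ?thesis unfolding almost_bounded_def by blast
qed

lemma almost_boundedE:
  assumes "almost_bounded I A"
  obtains r where "(r \<longlongrightarrow> 0) at_top" "\<And>M. 0 \<le> r M"
    "\<And>M. M > 0 \<Longrightarrow> \<forall>\<^sub>F n in along I. low_rank_plus_small (r M) M (A n)"
proof -
  obtain r where r: "(r \<longlongrightarrow> 0) at_top"
    "\<And>M. M > 0 \<Longrightarrow> \<forall>\<^sub>F n in along I. low_rank_plus_small (r M) M (A n)"
    using assms unfolding almost_bounded_def by blast
  show ?thesis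
  proof (rule that [of "\<lambda>M. \<bar>r M\<bar>"])
    show "((\<lambda>M. \<bar>r M\<bar>) \<longlongrightarrow> 0) at_top" using r(1) by (rule tendsto_rabs_zero)
    show "\<forall>\<^sub>F n in along I. low_rank_plus_small \<bar>r M\<bar> M (A n)" if "M > 0" for M
      using r(2) [OF that] by eventually_elim (auto intro: low_rank_plus_small_mono)
  qed simp
qed

text \<open>Both factors are truncated at \<open>sqrt M\<close>, so that the norm bounds multiply to
  \<open>M\<close>.\<close>

lemma almost_bounded_kron:
  assumes "almost_bounded I A" "almost_bounded I A'"
  shows "almost_bounded I (\<lambda>n. kron (A n) (A' n))"
proof -
  obtain r where r: "(r \<longlongrightarrow> 0) at_top" "\<And>M. 0 \<le> r M"
    "\<And>M. M > 0 \<Longrightarrow> \<forall>\<^sub>F n in along I. low_rank_plus_small (r M) M (A n)"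
    using almost_boundedE [OF assms(1)] by blast
  obtain r' where r': "(r' \<longlongrightarrow> 0) at_top" "\<And>M. 0 \<le> r' M"
    "\<And>M. M > 0 \<Longrightarrow> \<forall>\<^sub>F n in along I. low_rank_plus_small (r' M) M (A' n)"
    using almost_boundedE [OF assms(2)] by blast
  show ?thesis
    unfolding almost_bounded_def
  proof (intro exI conjI allI impI)
    show "((\<lambda>M. r (sqrt M) + r' (sqrt M)) \<longlongrightarrow> 0) at_top"
      by (intro tendsto_add_zero filterlim_compose [OF r(1) sqrt_at_top]
        filterlim_compose [OF r'(1) sqrt_at_top])
    fix M :: real assume "M > 0"
    then have M: "sqrt M > 0" "sqrt M * sqrt M = M" by simp_all
    show "\<forall>\<^sub>F n in along I. low_rank_plus_small (r (sqrt M) + r' (sqrt M)) M (kron (A n) (A' n))"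
      using r(3) [OF M(1)] r'(3) [OF M(1)]
    proof eventually_elim
      case (elim n)
      from low_rank_plus_small_kron [OF elim r(2) r'(2)] show ?case by (simp only: M(2))
    qed
  qed
qed

text \<open>Absolute values make the two bounds nonnegative, as the estimates for Kronecker products
  require, without changing their limits.\<close>

lemma acs_iff:
  "acs I B A \<longleftrightarrow> matrix_sequence I A \<and>
    (\<forall>m\<ge>1. \<forall>n\<in>I. B m n \<in> carrier_mat (dim_row (A n)) (dim_col (A n))) \<and>
    (\<exists>c \<omega>. c \<longlonglongrightarrow> 0 \<and> \<omega> \<longlonglongrightarrow> 0 \<and> (\<forall>m. 0 \<le> c m \<and> 0 \<le> \<omega> m) \<and>
      (\<forall>m\<ge>1. \<forall>\<^sub>F n in along I. low_rank_plus_small (c m) (\<omega> m) (A n - B m n)))"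
  (is "_ \<longleftrightarrow> ?ms \<and> ?B \<and> ?R")
proof -
  have eq: "A n = B m n + R + N \<longleftrightarrow> A n - B m n = R + N"
    if "B m n \<in> carrier_mat (dim_row (A n)) (dim_col (A n))"
      "R \<in> carrier_mat (dim_row (A n)) (dim_col (A n))"
        "N \<in> carrier_mat (dim_row (A n)) (dim_col (A n))"
    for m n R N
    using that by (auto simp: mat_eq_iff algebra_simps)
  let ?P = "\<lambda>c \<omega> m n. \<exists>R N. R \<in> carrier_mat (dim_row (A n)) (dim_col (A n)) \<and>
                N \<in> carrier_mat (dim_row (A n)) (dim_col (A n)) \<and>
                A n = B m n + R + N \<and>
                real (mat_rank R) \<le> c m * real (min (dim_row (A n)) (dim_col (A n))) \<and>
                spectral_norm N \<le> \<omega> m"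
  have *: "?P c \<omega> m n \<longleftrightarrow> low_rank_plus_small (c m) (\<omega> m) (A n - B m n)"
    if "B m n \<in> carrier_mat (dim_row (A n)) (dim_col (A n))" for c \<omega> :: "nat \<Rightarrow> real" and m n
  proof -
    have "spectral_norm N \<le> \<omega> m \<longleftrightarrow> opnorm_le (\<omega> m) N" for N
      using spectral_norm_le opnorm_le_spectral_norm opnorm_le_mono by blast
    moreover have "dim_row (A n - B m n) = dim_row (A n)" "dim_col (A n - B m n) = dim_col (A n)"
      using that by auto
    ultimately show ?thesis
      using eq [OF that] unfolding low_rank_plus_small_def by (intro ex_cong1) (simp only:, blast)
  qed
  show ?thesis
  proof (cases ?B)
    case True
    then have ev: "(\<forall>m\<ge>1. \<exists>n\<^sub>m. \<forall>n\<in>I. n \<ge> n\<^sub>m \<longrightarrow> ?P c \<omega> m n) \<longleftrightarrow>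
        (\<forall>m\<ge>1. \<forall>\<^sub>F n in along I. low_rank_plus_small (c m) (\<omega> m) (A n - B m n))"
      for c \<omega> :: "nat \<Rightarrow> real"
      unfolding eventually_along using * by (intro all_cong ex_cong1 ball_cong) auto
    have "acs I B A \<longleftrightarrow> ?ms \<and> (\<exists>c \<omega>. c \<longlonglongrightarrow> 0 \<and> \<omega> \<longlonglongrightarrow> 0 \<and>
        (\<forall>m\<ge>1. \<forall>\<^sub>F n in along I. low_rank_plus_small (c m) (\<omega> m) (A n - B m n)))" (is "_ \<longleftrightarrow> ?ms \<and> ?L")
      unfolding acs_def ev using True by simp
    also have "?L \<longleftrightarrow> ?R"
    proof
      assume ?L
      then obtain c \<omega> where c: "c \<longlonglongrightarrow> 0" "\<omega> \<longlonglongrightarrow> 0"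
        and lr: "\<And>m. m \<ge> 1 \<Longrightarrow> \<forall>\<^sub>F n in along I. low_rank_plus_small (c m) (\<omega> m) (A n - B m n)"
        by blast
      show ?R
      proof (intro exI conjI allI impI)
        show "(\<lambda>m. \<bar>c m\<bar>) \<longlonglongrightarrow> 0" "(\<lambda>m. \<bar>\<omega> m\<bar>) \<longlonglongrightarrow> 0"
          using c by (auto intro: tendsto_rabs_zero)
        fix m :: nat assume "m \<ge> 1"
        from lr [OF this] show "\<forall>\<^sub>F n in along I. low_rank_plus_small \<bar>c m\<bar> \<bar>\<omega> m\<bar> (A n - B m n)"
          by eventually_elim (auto intro: low_rank_plus_small_mono)
      qed auto
    qed blast
    finally show ?thesis using True by simp
  qed (auto simp: acs_def)
qed

lemma matrix_sequence_kron:
  assumes "matrix_sequence I A" "matrix_sequence I A'"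
  shows "matrix_sequence I (\<lambda>n. kron (A n) (A' n))"
proof -
  have mult: "filterlim (\<lambda>n. f n * g n) at_top F"
    if "filterlim f at_top F" "filterlim g at_top F" for f g :: "nat \<Rightarrow> nat" and F
    unfolding filterlim_at_top
  proof
    fix Z
    have "\<forall>\<^sub>F n in F. f n \<ge> Z" "\<forall>\<^sub>F n in F. g n \<ge> 1" using that by (auto simp: filterlim_at_top)
    then show "\<forall>\<^sub>F n in F. f n * g n \<ge> Z"
    proof eventually_elim
      case (elim n)
      then have "Z * 1 \<le> f n * g n" by (intro mult_mono) auto
      then show ?case by simp
    qed
  qed
  show ?thesis using assms unfolding matrix_sequence_def by (auto intro: mult)
qed

lemma acs_kron:
  assumes A: "almost_bounded I A" and A': "almost_bounded I A'" and B: "acs I B A" and B': "acs I B' A'"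
  shows "acs I (\<lambda>m n. kron (B m n) (B' m n)) (\<lambda>n. kron (A n) (A' n))"
proof -
  obtain r where r: "(r \<longlongrightarrow> 0) at_top" "\<And>M. 0 \<le> r M"
    "\<And>M. M > 0 \<Longrightarrow> \<forall>\<^sub>F n in along I. low_rank_plus_small (r M) M (A n)"
    using almost_boundedE [OF A] by blast
  obtain r' where r': "(r' \<longlongrightarrow> 0) at_top" "\<And>M. 0 \<le> r' M"
    "\<And>M. M > 0 \<Longrightarrow> \<forall>\<^sub>F n in along I. low_rank_plus_small (r' M) M (A' n)"
    using almost_boundedE [OF A'] by blast
  have ms: "matrix_sequence I A"
    and car: "\<And>m n. m \<ge> 1 \<Longrightarrow> n \<in> I \<Longrightarrow> B m n \<in> carrier_mat (dim_row (A n)) (dim_col (A n))"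
    using B by (auto simp: acs_def)
  have ms': "matrix_sequence I A'"
    and car': "\<And>m n. m \<ge> 1 \<Longrightarrow> n \<in> I \<Longrightarrow> B' m n \<in> carrier_mat (dim_row (A' n)) (dim_col (A' n))"
    using B' by (auto simp: acs_def)
  obtain c \<omega> where c: "c \<longlonglongrightarrow> 0" "\<omega> \<longlonglongrightarrow> 0" "\<And>m. 0 \<le> c m" "\<And>m. 0 \<le> \<omega> m"
    "\<And>m. m \<ge> 1 \<Longrightarrow> \<forall>\<^sub>F n in along I. low_rank_plus_small (c m) (\<omega> m) (A n - B m n)"
    using B unfolding acs_iff by blast
  obtain c' \<omega>' where c': "c' \<longlonglongrightarrow> 0" "\<omega>' \<longlonglongrightarrow> 0" "\<And>m. 0 \<le> c' m" "\<And>m. 0 \<le> \<omega>' m"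
    "\<And>m. m \<ge> 1 \<Longrightarrow> \<forall>\<^sub>F n in along I. low_rank_plus_small (c' m) (\<omega>' m) (A' n - B' m n)"
    using B' unfolding acs_iff by blast
  \<comment> \<open>The truncation level \<open>M m\<close> tends to infinity, but slowly enough that
    \<open>\<omega> m * M m\<close> and \<open>\<omega>' m * M m\<close> still tend to \<open>0\<close>.\<close>
  define s where "s m = \<omega> m + \<omega>' m + 1 / real (Suc m)" for m
  define M where "M m = 1 / sqrt (s m)" for m
  have s0: "s \<longlonglongrightarrow> 0"
    unfolding s_def using c(2) c'(2) LIMSEQ_inverse_real_of_nat
    by (intro tendsto_add_zero) (simp_all add: inverse_eq_divide)
  \<comment> \<open>Both \<open>\<omega> m\<close> and \<open>\<omega>' m\<close> may be 0; the
    summand \<open>1 / real (Suc m)\<close> keeps \<open>s m\<close> positive and hence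
    \<open>M m\<close> a genuine positive level.\<close>
  have spos: "s m > 0" for m
    using c(4) [of m] c'(4) [of m] by (simp add: s_def add_nonneg_pos)
  then have Mpos: "M m > 0" for m by (simp add: M_def)
  have sqrt_s: "(\<lambda>m. sqrt (s m)) \<longlonglongrightarrow> 0" using tendsto_real_sqrt [OF s0] by simp
  have "filterlim (\<lambda>m. inverse (sqrt (s m))) at_top sequentially"
    using spos by (intro filterlim_inverse_at_top sqrt_s) auto
  then have Mtop: "filterlim M at_top sequentially" by (simp add: M_def [abs_def] inverse_eq_divide)
  \<comment> \<open>The square root in \<open>M\<close> balances two demands: \<open>M\<close> tends
    to infinity, while \<open>s m * M m = sqrt (s m)\<close> still tends to 0.\<close>
  have small: "(\<lambda>m. f m * M m) \<longlonglongrightarrow> 0" if f: "\<And>m. 0 \<le> f m" "\<And>m. f m \<le> s m" for f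
  proof (rule tendsto_sandwich [OF _ _ tendsto_const sqrt_s])
    show "\<forall>\<^sub>F m in sequentially. 0 \<le> f m * M m" using f(1) Mpos by (simp add: less_imp_le)
    have "f m * M m \<le> sqrt (s m)" for m
    proof -
      have "f m * M m \<le> s m * M m" using f(2) Mpos by (simp add: less_imp_le mult_right_mono)
      also have "\<dots> = sqrt (s m)" using spos [of m] by (simp add: M_def real_div_sqrt)
      finally show ?thesis .
    qed
    then show "\<forall>\<^sub>F m in sequentially. f m * M m \<le> sqrt (s m)" by simp
  qed
  have w: "(\<lambda>m. \<omega> m * M m) \<longlonglongrightarrow> 0" "(\<lambda>m. \<omega>' m * M m) \<longlonglongrightarrow> 0"
    using c(4) c'(4) by (auto intro!: small simp: s_def)
  show ?thesis
    unfolding acs_iff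
  proof (intro conjI exI allI impI ballI)
    show "matrix_sequence I (\<lambda>n. kron (A n) (A' n))" by (rule matrix_sequence_kron [OF ms ms'])
    show "kron (B m n) (B' m n)
        \<in> carrier_mat (dim_row (kron (A n) (A' n))) (dim_col (kron (A n) (A' n)))"
      if "m \<ge> 1" "n \<in> I" for m n
      using car [OF that] car' [OF that] by (auto intro!: carrier_matI)
    show "(\<lambda>m. r (M m) + r' (M m) + c m + c' m) \<longlonglongrightarrow> 0"
      by (intro tendsto_add_zero c(1) c'(1) filterlim_compose [OF r(1) Mtop]
        filterlim_compose [OF r'(1) Mtop])
    have "(\<lambda>m. \<omega> m * M m + (\<omega>' m * M m + \<omega> m * \<omega>' m)) \<longlonglongrightarrow> 0"
      by (intro tendsto_add_zero w tendsto_mult_zero c(2) c'(2))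
    then show "(\<lambda>m. \<omega> m * M m + (M m + \<omega> m) * \<omega>' m) \<longlonglongrightarrow> 0" by (simp add: algebra_simps)
    show "0 \<le> r (M m) + r' (M m) + c m + c' m" for m using r(2) r'(2) c(3) c'(3) by simp
    show "0 \<le> \<omega> m * M m + (M m + \<omega> m) * \<omega>' m" for m
      using Mpos [of m] c(4) [of m] c'(4) [of m] by simp
    fix m :: nat assume m: "m \<ge> 1"
    \<comment> \<open>The sizes of \<open>B m n\<close> and \<open>B' m n\<close> are known only for
      indices in \<open>I\<close>.\<close>
    have "\<forall>\<^sub>F n in along I. n \<in> I" by (auto simp: eventually_along)
    with r(3) [OF Mpos [of m]] r'(3) [OF Mpos [of m]] c(5) [OF m] c'(5) [OF m]
    show "\<forall>\<^sub>F n in along I. low_rank_plus_small (r (M m) + r' (M m) + c m + c' m)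
        (\<omega> m * M m + (M m + \<omega> m) * \<omega>' m) (kron (A n) (A' n) - kron (B m n) (B' m n))"
    proof eventually_elim
      case (elim n)
      show ?case
        by (rule low_rank_plus_small_kron_diff)
          (use elim r(2) r'(2) c(3) c'(3) car [OF m] car' [OF m] in simp_all)
    qed
  qed
qed

text \<open>Both properties go through the induction together, since \<open>acs_kron\<close> also
  asks for almost boundedness of the product of the remaining factors.\<close>

lemma kron_list_almost_bounded_acs:
  assumes "is \<noteq> []" "\<And>i. i \<in> set is \<Longrightarrow> almost_bounded I (A i)" "\<And>i. i \<in> set is \<Longrightarrow> acs I (B i) (A i)"
  shows "almost_bounded I (\<lambda>n. kron_list (map (\<lambda>i. A i n) is)) \<and>
    acs I (\<lambda>m n. kron_list (map (\<lambda>i. B i m n) is)) (\<lambda>n. kron_list (map (\<lambda>i. A i n) is))"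
  using assms
proof (induction "is" rule: list_nonempty_induct)
  case (single i)
  then show ?case by (simp add: kron_list_single)
next
  case (cons i js)
  then show ?case by (simp add: kron_list_Cons almost_bounded_kron acs_kron)
qed

theorem corollary5p1:
  fixes d :: nat and I :: "nat set"
    and A :: "nat \<Rightarrow> nat \<Rightarrow> complex mat"
    and B :: "nat \<Rightarrow> nat \<Rightarrow> nat \<Rightarrow> complex mat"
  assumes "d \<ge> 1"
    and "\<And>i. i \<in> {1..d} \<Longrightarrow> sparsely_unbounded I (A i)"
    and "\<And>i. i \<in> {1..d} \<Longrightarrow> acs I (B i) (A i)"
  shows "acs I (\<lambda>m n. kron_list (map (\<lambda>i. B i m n) [1..<Suc d]))
               (\<lambda>n. kron_list (map (\<lambda>i. A i n) [1..<Suc d]))"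
proof -
  have idx: "[1..<Suc d] \<noteq> []" "\<And>i. i \<in> set [1..<Suc d] \<Longrightarrow> i \<in> {1..d}"
    using \<open>d \<ge> 1\<close> by auto
  show ?thesis
    by (rule kron_list_almost_bounded_acs [THEN conjunct2, OF idx(1)])
      (blast intro: sparsely_unbounded_imp_almost_bounded assms(2,3) dest: idx(2))+
qed

end
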